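(* Let $\mu\in\mathbb{C}$, $\mu\neq 0$. For any $\sigma\in\Omega:=\mathbb{C}\setminus\{(-\infty,0)\cup[1,+\infty)\}$, any $a\in\mathbb{C}$, $a\neq 0$, any $\theta_1,\theta_2\in\mathbb{R}$ and any $0<\tilde\sigma<1$, there exists a sufficiently small positive $\epsilon$ such that equation $PVI_\mu$ has a solution (transcendent) $y(x;\sigma,a)$ with behaviour $$y(x;\sigma,a)=a\,x^{1-\sigma}\bigl(1+O(|x|^{\delta})\bigr),\qquad 0<\delta<1,$$ as $x\to 0$ in $D(\epsilon;\sigma;\theta_1,\theta_2,\tilde\sigma)$. This local behaviour is valid with an exception, which occurs if $\operatorname{Im}\sigma\neq 0$ and $x\to 0$ along the special paths $\operatorname{Im}\sigma\,\arg(x)=\operatorname{Re}\sigma\,\log|x|+d$, where $d$ is a constant such that the path is contained in $D(\epsilon;\sigma;\theta_1,\theta_2,\tilde\sigma)$. Along such a path the local behaviour becomes $$y(x;\sigma,a)=a(x)\,x^{1-\sigma}\bigl(1+O(|x|^{\delta})\bigr),\qquad a(x)=a\left(1+\frac{1}{2a}\,C e^{i\alpha(x)}+\frac{1}{16a^2}\,C^2e^{2i\alpha(x)}\right)=O(1)\ \text{ for } x\to0,$$ where along the path $x^{\sigma}=Ce^{i\alpha(x)}$, with $C:=e^{-d}$ and $\alpha(x):=\operatorname{Re}\sigma\,\arg(x)+\operatorname{Im}\sigma\,\ln|x|$ evaluated on $\operatorname{Im}\sigma\,\arg(x)=\operatorname{Re}\sigma\,\log|x|+d$.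
   Context: $PVI_\mu$ is the Painlevé VI equation $$\frac{d^2y}{dx^2}=\frac12\left[\frac1y+\frac1{y-1}+\frac1{y-x}\right]\left(\frac{dy}{dx}\right)^2-\left[\frac1x+\frac1{x-1}+\frac1{y-x}\right]\frac{dy}{dx}+\frac12\,\frac{y(y-1)(y-x)}{x^2(x-1)^2}\left[(2\mu-1)^2+\frac{x(x-1)}{(y-x)^2}\right].$$ Let $\widetilde{\mathbb{C}_0}$ be the universal covering of $\mathbb{C}_0=\mathbb{C}\setminus\{0\}$; a point $x\in\widetilde{\mathbb{C}_0}$ is given by $|x|>0$ and $\arg(x)\in(-\infty,+\infty)$, and $x^\sigma=e^{\sigma(\ln|x|+i\arg x)}$. For $0<\epsilon<1$, $\theta_1,\theta_2\in\mathbb{R}$, $0<\tilde\sigma<1$, define for $\sigma\ne0$ $$D(\epsilon;\sigma;\theta_1,\theta_2,\tilde\sigma):=\{x\in\widetilde{\mathbb{C}_0}:\ |x|<\epsilon,\ e^{-\theta_1\operatorname{Im}\sigma}|x|^{\tilde\sigma}\le|x^\sigma|\le e^{-\theta_2\operatorname{Im}\sigma}\},$$ equivalently $|x|<\epsilon$ and $\operatorname{Re}\sigma\log|x|+\theta_2\operatorname{Im}\sigma\le\operatorname{Im}\sigma\arg(x)\le(\operatorname{Re}\sigma-\tilde\sigma)\log|x|+\theta_1\operatorname{Im}\sigma$. For $\sigma=0$ the domain is simply $\{x\in\widetilde{\mathbb{C}_0}:|x|<\epsilon\}$. The small number $\epsilon$ depends on $\tilde\sigma$, $\theta_1$ and 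$a$.
   Formalization: For Im σ≠0 the behaviour a x^{1-σ}(1+O(|x|^δ)) is claimed only where |x^σ|≤K|x|^s (any s,K>0; δ may depend on them); on special paths with C=4|a| only y=(a(x)+O(|x|^δ))x^{1-σ}; where y is 0, 1 or x the equation is taken with denominators cleared, so (σ,a)=(0,1) allows y=x. *)

theory Defs
  imports "HOL-Complex_Analysis.Complex_Analysis"
begin

text \<open>
  A point \<open>x\<close> of the universal covering of \<open>\<complex> - {0}\<close> is represented by its logarithm
  \<open>t = ln |x| + \<i> arg x\<close>, a complex number.  Thus \<open>exp t\<close> is the projection of \<open>x\<close> to the
  punctured plane, \<open>Re t = ln |x|\<close>, and \<open>Im t = arg x\<close> is unrestricted.
\<close>

type_synonym cover = complex

definition cabs :: "cover \<Rightarrow> real" where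
  "cabs t = norm (exp t)"

definition carg :: "cover \<Rightarrow> real" where
  "carg t = Im t"

definition cpow :: "cover \<Rightarrow> complex \<Rightarrow> complex" where
  "cpow t \<sigma> = exp (\<sigma> * (of_real (ln (cabs t)) + \<i> * of_real (carg t)))"

lemma cabs_eq: "cabs t = exp (Re t)"
  by (simp add: cabs_def)

lemma cpow_eq: "cpow t \<sigma> = exp (\<sigma> * t)"
proof -
  have "of_real (Re t) + \<i> * of_real (Im t) = t"
    by (simp add: complex_eq_iff)
  thus ?thesis by (simp add: cpow_def cabs_eq carg_def)
qed

definition to_zero_in :: "cover set \<Rightarrow> cover filter" where
  "to_zero_in S = inf (filtercomap exp (nhds 0)) (principal S)"

text \<open>The derivation \<open>d/dx\<close> in the coordinate \<open>t\<close>, where \<open>x = exp t\<close>.\<close>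

definition ddx :: "(cover \<Rightarrow> complex) \<Rightarrow> cover \<Rightarrow> complex" where
  "ddx Y t = deriv Y t / exp t"

definition PVI_rhs :: "complex \<Rightarrow> complex \<Rightarrow> complex \<Rightarrow> complex \<Rightarrow> complex" where
  "PVI_rhs \<mu> x y y' =
     1/2 * (1/y + 1/(y - 1) + 1/(y - x)) * y'^2
     - (1/x + 1/(x - 1) + 1/(y - x)) * y'
     + 1/2 * (y * (y - 1) * (y - x) / (x^2 * (x - 1)^2))
         * ((2*\<mu> - 1)^2 + x * (x - 1) / (y - x)^2)"

text \<open>The equation multiplied by \<open>y (y - 1) (y - x)\<close>.\<close>

definition PVI_cleared ::
  "complex \<Rightarrow> complex \<Rightarrow> complex \<Rightarrow> complex \<Rightarrow> complex \<Rightarrow> bool" where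
  "PVI_cleared \<mu> x y y' y'' \<longleftrightarrow>
     y * (y - 1) * (y - x) * y'' =
       1/2 * ((y - 1) * (y - x) + y * (y - x) + y * (y - 1)) * y'^2
       - ((1/x + 1/(x - 1)) * (y * (y - 1) * (y - x)) + y * (y - 1)) * y'
       + 1/2 * (y^2 * (y - 1)^2 / (x^2 * (x - 1)^2))
           * ((2*\<mu> - 1)^2 * (y - x)^2 + x * (x - 1))"

text \<open>
  A holomorphic solution may take the values \<open>0\<close>, \<open>1\<close>, \<open>x\<close> at some points (they are then double
  points of \<open>y\<close>, \<open>y - 1\<close>, \<open>y - x\<close>), where the right-hand side of the equation has the
  indeterminate form \<open>0/0\<close>.  At such points the equation with cleared denominators is required.
\<close>

definition PVI_eq ::
  "complex \<Rightarrow> complex \<Rightarrow> complex \<Rightarrow> complex \<Rightarrow> complex \<Rightarrow> bool" where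
  "PVI_eq \<mu> x y y' y'' \<longleftrightarrow>
     (if y \<noteq> 0 \<and> y \<noteq> 1 \<and> y \<noteq> x then y'' = PVI_rhs \<mu> x y y'
      else PVI_cleared \<mu> x y y' y'')"

lemma PVI_eq_iff_cleared:
  assumes "x \<noteq> 0" "x \<noteq> 1"
  shows "PVI_eq \<mu> x y y' y'' \<longleftrightarrow> PVI_cleared \<mu> x y y' y''"
proof (cases "y \<noteq> 0 \<and> y \<noteq> 1 \<and> y \<noteq> x")
  case True
  define P where "P = y * (y - 1) * (y - x)"
  have nz: "y \<noteq> 0" "y - 1 \<noteq> 0" "y - x \<noteq> 0" and P: "P \<noteq> 0"
    using True by (auto simp: P_def)
  have c1: "P * (1/y + 1/(y - 1) + 1/(y - x))
      = (y - 1) * (y - x) + y * (y - x) + y * (y - 1)"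
  proof -
    have "P * (1/y) = (y - 1) * (y - x)" "P * (1/(y - 1)) = y * (y - x)"
      "P * (1/(y - x)) = y * (y - 1)"
      using nz by (simp_all add: P_def)
    thus ?thesis by (simp only: distrib_left)
  qed
  have c2: "P * (1/x + 1/(x - 1) + 1/(y - x)) = (1/x + 1/(x - 1)) * P + y * (y - 1)"
  proof -
    have "P * (1/(y - x)) = y * (y - 1)"
      using nz by (simp add: P_def)
    thus ?thesis by (simp only: distrib_left distrib_right mult.commute)
  qed
  have c3: "P * (P * ((2*\<mu> - 1)^2 + x * (x - 1) / (y - x)^2))
      = y^2 * (y - 1)^2 * ((2*\<mu> - 1)^2 * (y - x)^2 + x * (x - 1))"
  proof -
    have "P * P = y^2 * (y - 1)^2 * (y - x)^2"
      by (simp add: P_def power2_eq_square)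
    moreover have "(y - x)^2 * ((2*\<mu> - 1)^2 + x * (x - 1) / (y - x)^2)
        = (2*\<mu> - 1)^2 * (y - x)^2 + x * (x - 1)"
      using nz by (simp add: distrib_left mult.commute)
    ultimately show ?thesis by (metis mult.assoc)
  qed
  have "P * PVI_rhs \<mu> x y y' =
      1/2 * (P * (1/y + 1/(y - 1) + 1/(y - x))) * y'^2
      - (P * (1/x + 1/(x - 1) + 1/(y - x))) * y'
      + 1/2 * (P * (P * ((2*\<mu> - 1)^2 + x * (x - 1) / (y - x)^2))) / (x^2 * (x - 1)^2)"
  proof -
    have "P * (1/2 * A * y'^2 - B * y' + 1/2 * (P / d) * G)
        = 1/2 * (P * A) * y'^2 - (P * B) * y' + 1/2 * (P * (P * G)) / d" for A B G d
      by (simp add: algebra_simps)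
    thus ?thesis unfolding PVI_rhs_def P_def[symmetric] by blast
  qed
  hence "P * PVI_rhs \<mu> x y y' =
      1/2 * ((y - 1) * (y - x) + y * (y - x) + y * (y - 1)) * y'^2
       - ((1/x + 1/(x - 1)) * P + y * (y - 1)) * y'
       + 1/2 * (y^2 * (y - 1)^2 / (x^2 * (x - 1)^2))
           * ((2*\<mu> - 1)^2 * (y - x)^2 + x * (x - 1))"
    unfolding c1 c2 c3 by simp
  hence "PVI_cleared \<mu> x y y' y'' \<longleftrightarrow> P * y'' = P * PVI_rhs \<mu> x y y'"
    unfolding PVI_cleared_def P_def[symmetric] by simp
  thus ?thesis using True P by (simp add: PVI_eq_def)
next
  case False
  thus ?thesis by (simp only: PVI_eq_def if_False)
qed

definition PVI_solution :: "complex \<Rightarrow> (cover \<Rightarrow> complex) \<Rightarrow> cover set \<Rightarrow> bool" where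
  "PVI_solution \<mu> Y S \<longleftrightarrow>
     Y analytic_on S \<and> (\<forall>t\<in>S. PVI_eq \<mu> (exp t) (Y t) (ddx Y t) (ddx (ddx Y) t))"

definition Omega :: "complex set" where
  "Omega = UNIV - complex_of_real ` ({..<0} \<union> {1..})"

definition Dom :: "real \<Rightarrow> complex \<Rightarrow> real \<Rightarrow> real \<Rightarrow> real \<Rightarrow> cover set" where
  "Dom \<epsilon> \<sigma> \<theta>1 \<theta>2 \<sigma>' =
     (if \<sigma> = 0 then {t. cabs t < \<epsilon>}
      else {t. cabs t < \<epsilon> \<and>
               exp (- \<theta>1 * Im \<sigma>) * cabs t powr \<sigma>' \<le> norm (cpow t \<sigma>) \<and>
               norm (cpow t \<sigma>) \<le> exp (- \<theta>2 * Im \<sigma>)})"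

text \<open>\<open>Y = g (1 + O(|x|^\<delta>))\<close>, respectively \<open>Y = (c + O(|x|^\<delta>)) g\<close>, as \<open>x \<rightarrow> 0\<close> in \<open>S\<close>.\<close>

definition asymp_mult ::
  "(cover \<Rightarrow> complex) \<Rightarrow> (cover \<Rightarrow> complex) \<Rightarrow> real \<Rightarrow> cover set \<Rightarrow> bool" where
  "asymp_mult Y g \<delta> S \<longleftrightarrow>
     (\<exists>E. (\<forall>t\<in>S. Y t = g t * (1 + E t)) \<and>
          (\<lambda>t. norm (E t)) \<in> O[to_zero_in S](\<lambda>t. cabs t powr \<delta>))"

definition asymp_add ::
  "(cover \<Rightarrow> complex) \<Rightarrow> (cover \<Rightarrow> complex) \<Rightarrow> (cover \<Rightarrow> complex) \<Rightarrow> real \<Rightarrow> cover set \<Rightarrow> bool" where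
  "asymp_add Y c g \<delta> S \<longleftrightarrow>
     (\<exists>E. (\<forall>t\<in>S. Y t = (c t + E t) * g t) \<and>
          (\<lambda>t. norm (E t)) \<in> O[to_zero_in S](\<lambda>t. cabs t powr \<delta>))"

text \<open>
  The special paths are the curves \<open>|x^\<sigma>| = const\<close>; for \<open>Im \<sigma> \<noteq> 0\<close> they foliate the whole
  covering.  Approaching \<open>0\<close> away from their direction therefore means that \<open>|x^\<sigma>|\<close> decays
  like some positive power of \<open>|x|\<close>, i.e. that \<open>x\<close> stays in one of the regions \<open>off_special\<close>, which
  in logarithmic coordinates are
  \<open>Im \<sigma> arg x \<ge> (Re \<sigma> - s) ln |x| - ln K\<close>, for some \<open>s > 0\<close>, \<open>K > 0\<close>.
\<close>

definition special_path :: "complex \<Rightarrow> real \<Rightarrow> cover set" where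
  "special_path \<sigma> d = {t. Im \<sigma> * carg t = Re \<sigma> * ln (cabs t) + d}"

definition off_special :: "complex \<Rightarrow> real \<Rightarrow> real \<Rightarrow> cover set" where
  "off_special \<sigma> s K = {t. norm (cpow t \<sigma>) \<le> K * cabs t powr s}"

definition phase :: "complex \<Rightarrow> cover \<Rightarrow> real" where
  "phase \<sigma> t = Re \<sigma> * carg t + Im \<sigma> * ln (cabs t)"

text \<open>
  On the special path with constant \<open>d\<close>, where \<open>C = exp (- d)\<close>, the coefficient below equals
  \<open>a (1 + x^\<sigma> / (4 a))^2\<close>; it has zeros on that path if and only if \<open>C = 4 |a|\<close>.
\<close>

definition coeff_along :: "complex \<Rightarrow> complex \<Rightarrow> real \<Rightarrow> cover \<Rightarrow> complex" where
  "coeff_along \<sigma> a C t =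
     a * (1 + 1 / (2*a) * of_real C * exp (\<i> * of_real (phase \<sigma> t))
            + 1 / (16 * a^2) * of_real C ^ 2 * exp (2 * \<i> * of_real (phase \<sigma> t)))"

end

theory Submission
  imports Defs
begin

text \<open>
  In the coordinate \<open>t = log x\<close> put \<open>y = x (cosh (v / 2))^2\<close>.  To leading order the equation becomes
  \<open>v'' = 0\<close>, and exactly it reads \<open>v'' = G (t, v, v')\<close>, where every term of \<open>G\<close> carries one of the factors
  \<open>x\<close>, \<open>x e^v\<close>, \<open>x e^(-v)\<close> and the only denominators are powers of \<open>x - 1\<close> and \<open>y - 1\<close>: the singularities
  at \<open>y = 0\<close> and \<open>y = x\<close> have disappeared.  For \<open>e^v = c x^(-\<sigma>) e^\<phi>\<close> these factors are \<open>O(|x|^k)\<close> with some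
  \<open>k > 0\<close> on the domain, and the domain is mapped into itself by translations of \<open>t\<close> along a direction in
  which \<open>x \<rightarrow> 0\<close> and \<open>|x^\<sigma>|\<close> stays constant (or decays, for real \<open>\<sigma>\<close>).  Integrating twice along it gives a
  contraction for \<open>(\<phi>, \<phi>')\<close> near \<open>x = 0\<close>, hence a solution with \<open>\<phi> = O(|x|^k)\<close>.  Finally
  \<open>4 y = c x^(1 - \<sigma>) e^\<phi> + 2 x + x^(1 + \<sigma>) e^(-\<phi>) / c\<close> is
  \<open>x^(1 - \<sigma>) (c (1 + x^\<sigma> / c)^2 + O(|x|^k))\<close>, which with \<open>c = 4 a\<close> contains all the asserted behaviours.
\<close>

section \<open>Integration from \<open>x = 0\<close> of functions of size
  \<open>|x|^k\<close>\<close>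

section \<open>Decaying primitives\<close>

text \<open>This models a neighbourhood of \<open>x = 0\<close> in the coordinate
  \<open>t = log x\<close>. Since \<open>Re l = 1\<close>, moving by \<open>- u * l\<close> lowers
  \<open>ln |x|\<close> at unit speed; \<open>weight t\<close> is \<open>|x|^k\<close>.\<close>

locale contracting_domain =
  fixes S :: "complex set" and l :: complex and k :: real
  assumes open_S: "open S" and convex_S: "convex S"
    and Re_l: "Re l = 1" and k_pos: "0 < k"
    and shift: "\<And>t u. t \<in> S \<Longrightarrow> 0 \<le> u \<Longrightarrow> t - of_real u * l \<in> S"
begin

definition weight :: "complex \<Rightarrow> real" where "weight t = exp (k * Re t)"

text \<open>Integrating \<open>weight\<close> along the ray \<open>t - u l\<close> multiplies it by at most this constant.\<close>

definition gain :: real where "gain = norm l / k"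

lemma weight_pos [simp]: "0 < weight t" "0 \<le> weight t" "weight t \<noteq> 0"
  by (simp_all add: weight_def)

lemma gain_nonneg [simp]: "0 \<le> gain"
  using k_pos by (simp add: gain_def)

lemma weight_shift: "weight (t - of_real u * l) = weight t * exp (- k * u)"
  using Re_l by (simp add: weight_def exp_add [symmetric] algebra_simps)

lemma weighted_bound_nonneg:
  fixes z :: complex
  assumes "norm z \<le> m * weight t"
  shows "0 \<le> m"
proof (rule ccontr)
  assume "\<not> 0 \<le> m"
  hence "m * weight t < 0" by (intro mult_neg_pos) auto
  thus False using assms norm_ge_zero[of z] by linarith
qed

lemma shift_tendsto: "(\<lambda>n. weight (t - of_real (real n) * l)) \<longlonglongrightarrow> 0"
proof -
  have "(\<lambda>n. weight t * exp (- k * real n)) \<longlonglongrightarrow> 0"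
    using k_pos by real_asymp
  thus ?thesis unfolding weight_shift .
qed

text \<open>Along the ray the derivative of \<open>F\<close> is at most
  \<open>norm l * m * weight t * exp (- k * v)\<close>, whose integral over \<open>v \<ge> 0\<close>
  is \<open>gain * m * weight t\<close>. A comparison with the majorant \<open>?\<phi>\<close> takes
  the place of the integral.\<close>

lemma shift_increment_bound:
  assumes F: "\<And>t. t \<in> S \<Longrightarrow> (F has_field_derivative f t) (at t)"
    and f: "\<And>t. t \<in> S \<Longrightarrow> norm (f t) \<le> m * weight t"
    and t: "t \<in> S" and u: "0 \<le> u"
  shows "norm (F (t - of_real u * l) - F t) \<le> gain * m * weight t"
proof (cases "u = 0")
  case True
  thus ?thesis using weighted_bound_nonneg[OF f[OF t]] by simp
next
  case False
  let ?g = "\<lambda>v::real. t - of_real v * l"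
  let ?\<phi> = "\<lambda>v::real. - (gain * m * weight t) * exp (- k * v)"
  have dg: "((\<lambda>v. F (?g v)) has_vector_derivative (- l * f (?g v))) (at v)" if "0 \<le> v" for v
  proof -
    have "(?g has_vector_derivative (- l)) (at v)"
      by (auto intro!: derivative_eq_intros simp: has_vector_derivative_def scaleR_conv_of_real)
    from field_vector_diff_chain_at[OF this F[OF shift[OF t that]]]
    show ?thesis by (simp add: o_def)
  qed
  have d\<phi>: "(?\<phi> has_vector_derivative (norm l * m * weight t * exp (- k * v))) (at v)" for v
    using k_pos by (auto intro!: derivative_eq_intros simp: gain_def
        simp flip: has_real_derivative_iff_has_vector_derivative)
  have m0: "0 \<le> m" by (rule weighted_bound_nonneg[OF f[OF t]])
  have "norm (F (?g u) - F (?g 0)) \<le> ?\<phi> u - ?\<phi> 0"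
  proof (rule differentiable_bound_general)
    show "0 < u" using u False by simp
    show "continuous_on {0..u} (\<lambda>v. F (?g v))"
      by (rule continuous_on_vector_derivative[OF has_vector_derivative_at_within[OF dg]]) auto
    show "continuous_on {0..u} ?\<phi>" by (intro continuous_intros)
    show "((\<lambda>v. F (?g v)) has_vector_derivative (- l * f (?g v))) (at v)" if "0 < v" for v
      using dg that by simp
    show "(?\<phi> has_vector_derivative (norm l * m * weight t * exp (- k * v))) (at v)" for v
      by (rule d\<phi>)
    show "norm (- l * f (?g v)) \<le> norm l * m * weight t * exp (- k * v)" if "0 < v" for v
      using mult_left_mono[OF f[OF shift[OF t, of v]], of "norm l"] that
      by (simp add: norm_mult weight_shift mult.assoc)
  qed
  also have "\<dots> = gain * (m * weight t) * (1 - exp (- k * u))" by (simp add: algebra_simps)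
  also have "\<dots> \<le> gain * (m * weight t) * 1"
    using m0 by (intro mult_left_mono mult_nonneg_nonneg) auto
  finally show ?thesis by (simp add: mult.assoc)
qed

text \<open>The bound with \<open>C\<close> forces \<open>F\<close> to vanish at the end of the ray;
  the increment bound then yields a constant independent of \<open>C\<close>.\<close>

lemma primitive_bound:
  assumes F: "\<And>t. t \<in> S \<Longrightarrow> (F has_field_derivative f t) (at t)"
    and f: "\<And>t. t \<in> S \<Longrightarrow> norm (f t) \<le> m * weight t"
    and FC: "\<And>t. t \<in> S \<Longrightarrow> norm (F t) \<le> C * weight t"
    and t: "t \<in> S"
  shows "norm (F t) \<le> gain * m * weight t"
proof -
  have "(\<lambda>n. gain * m * weight t + C * weight (t - of_real (real n) * l)) \<longlonglongrightarrow> gain * m * weight t + C * 0"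
    by (intro tendsto_intros shift_tendsto)
  moreover have "norm (F t) \<le> gain * m * weight t + C * weight (t - of_real (real n) * l)" for n
  proof -
    have "norm (F t) \<le> norm (F (t - of_real (real n) * l) - F t) + norm (F (t - of_real (real n) * l))"
      by norm
    also have "\<dots> \<le> gain * m * weight t + C * weight (t - of_real (real n) * l)"
      by (intro add_mono shift_increment_bound[OF F f t] FC shift t) auto
    finally show ?thesis .
  qed
  ultimately show ?thesis by (simp add: LIMSEQ_le_const)
qed

text \<open>Convexity gives some primitive. It has a limit along every ray, the limit
  \<open>L\<close> is common to all rays, and subtracting \<open>L\<close> produces the
  decay.\<close>

lemma decaying_primitive_exists:
  assumes hol: "f holomorphic_on S" and f: "\<And>t. t \<in> S \<Longrightarrow> norm (f t) \<le> m * weight t"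
  shows "\<exists>F. (\<forall>t\<in>S. (F has_field_derivative f t) (at t)) \<and> (\<exists>C. \<forall>t\<in>S. norm (F t) \<le> C * weight t)"
proof (cases "S = {}")
  case False
  then obtain t0 where t0: "t0 \<in> S" by auto
  obtain F where "\<And>t. t \<in> S \<Longrightarrow> (F has_field_derivative f t) (at t within S)"
    using holomorphic_convex_primitive'[OF convex_S open_S hol] by blast
  hence F: "\<And>t. t \<in> S \<Longrightarrow> (F has_field_derivative f t) (at t)"
    by (simp add: at_within_open[OF _ open_S])
  let ?g = "\<lambda>t n. t - of_real (real n) * l"
  have gS: "?g t n \<in> S" if "t \<in> S" for t n using shift[OF that, of "real n"] by simp
  have m0: "0 \<le> m" by (rule weighted_bound_nonneg[OF f[OF t0]])
  \<comment> \<open>Every point of the ray after index \<open>N\<close> is a shift of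
    \<open>?g t0 N\<close>, so a single increment bound controls the tail.\<close>
  have "Cauchy (\<lambda>n. F (?g t0 n))"
  proof (rule metric_CauchyI)
    fix e :: real assume e: "0 < e"
    have "(\<lambda>n. gain * m * weight (?g t0 n)) \<longlonglongrightarrow> gain * m * 0"
      by (intro tendsto_intros shift_tendsto)
    hence "\<forall>\<^sub>F n in sequentially. gain * m * weight (?g t0 n) < e/2"
      using e by (intro order_tendstoD(2)) auto
    then obtain N where N: "gain * m * weight (?g t0 N) < e/2"
      by (auto simp: eventually_sequentially)
    have *: "dist (F (?g t0 n)) (F (?g t0 N)) < e/2" if "N \<le> n" for n
    proof -
      have eq: "?g t0 n = ?g t0 N - of_real (real (n - N)) * l"
        using that by (simp add: of_nat_diff algebra_simps)
      have "norm (F (?g t0 N - of_real (real (n - N)) * l) - F (?g t0 N)) \<le> gain * m * weight (?g t0 N)"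
        by (rule shift_increment_bound[OF F f gS[OF t0]]) auto
      thus ?thesis unfolding eq dist_norm using N by (rule order.strict_trans1)
    qed
    show "\<exists>M. \<forall>p\<ge>M. \<forall>n\<ge>M. dist (F (?g t0 p)) (F (?g t0 n)) < e"
      by (intro exI[of _ N] allI impI dist_triangle_half_l[OF * *])
  qed
  then obtain L where L: "(\<lambda>n. F (?g t0 n)) \<longlonglongrightarrow> L"
    using Cauchy_convergent convergent_def by blast
  \<comment> \<open>Two parallel rays keep the constant distance \<open>norm (t - t0)\<close>, while
    the derivative on the segment joining them is \<open>O(exp (- k * n))\<close>, because that
    segment lies in a half plane moving to the left with \<open>n\<close>.\<close>
  have lim: "(\<lambda>n. F (?g t n)) \<longlonglongrightarrow> L" if t: "t \<in> S" for t
  proof -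
    define B where "B = exp (k * max (Re t) (Re t0))"
    have le: "norm (F (?g t n) - F (?g t0 n)) \<le> m * (B * exp (- k * real n)) * norm (t - t0)" for n
    proof -
      have seg: "closed_segment (?g t n) (?g t0 n) \<subseteq> S"
        by (rule closed_segment_subset[OF gS[OF t] gS[OF t0] convex_S])
      have "norm (F (?g t n) - F (?g t0 n)) \<le> m * (B * exp (- k * real n)) * norm (?g t n - ?g t0 n)"
      proof (rule field_differentiable_bound[where S = "closed_segment (?g t n) (?g t0 n)" and f' = f])
        fix z assume z: "z \<in> closed_segment (?g t n) (?g t0 n)"
        hence zS: "z \<in> S" using seg by (rule rev_subsetD)
        show "(F has_field_derivative f z) (at z within closed_segment (?g t n) (?g t0 n))"
          by (rule has_field_derivative_at_within[OF F[OF zS]])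
        have "Re z \<le> max (Re t) (Re t0) - real n"
        proof -
          have "z \<in> {w. Re w \<le> max (Re t) (Re t0) - real n}"
          proof (rule rev_subsetD[OF z closed_segment_subset])
            show "convex {w. Re w \<le> max (Re t) (Re t0) - real n}"
              by (rule convex_halfspace_Re_le)
          qed (simp_all add: Re_l)
          thus ?thesis by simp
        qed
        hence "k * Re z \<le> k * (max (Re t) (Re t0) - real n)"
          using k_pos by (intro mult_left_mono) auto
        hence "weight z \<le> exp (k * (max (Re t) (Re t0) - real n))"
          by (simp add: weight_def)
        also have "\<dots> = B * exp (- k * real n)"
          by (simp add: B_def right_diff_distrib flip: exp_add)
        finally have "m * weight z \<le> m * (B * exp (- k * real n))"
          using m0 by (rule mult_left_mono)
        thus "norm (f z) \<le> m * (B * exp (- k * real n))"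
          using f[OF zS] by (rule order.trans[rotated])
      qed simp_all
      thus ?thesis by simp
    qed
    have "(\<lambda>n. exp (- k * real n)) \<longlonglongrightarrow> 0"
      using k_pos by real_asymp
    hence "(\<lambda>n. m * (B * exp (- k * real n)) * norm (t - t0)) \<longlonglongrightarrow> m * (B * 0) * norm (t - t0)"
      by (intro tendsto_mult tendsto_const)
    hence "(\<lambda>n. m * (B * exp (- k * real n)) * norm (t - t0)) \<longlonglongrightarrow> 0" by simp
    hence "(\<lambda>n. F (?g t n) - F (?g t0 n)) \<longlonglongrightarrow> 0"
      by (rule Lim_null_comparison[OF always_eventually[OF allI[OF le]]])
    from tendsto_add[OF this L] show ?thesis by simp
  qed
  have "norm (F t - L) \<le> (gain * m) * weight t" if t: "t \<in> S" for t
  proof (rule LIMSEQ_le_const2)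
    show "(\<lambda>n. norm (F t - F (?g t n))) \<longlonglongrightarrow> norm (F t - L)"
      by (intro tendsto_intros lim t)
    show "\<exists>N. \<forall>n\<ge>N. norm (F t - F (?g t n)) \<le> gain * m * weight t"
      using shift_increment_bound[OF F f t, of "real _"] by (auto simp: norm_minus_commute)
  qed
  moreover have "((\<lambda>t. F t - L) has_field_derivative f t) (at t)" if "t \<in> S" for t
    using F[OF that] by (auto intro!: derivative_eq_intros)
  ultimately show ?thesis by (intro exI[of _ "\<lambda>t. F t - L"] exI[of _ "gain * m"] conjI ballI)
qed auto

text \<open>Decay makes the primitive unique on \<open>S\<close>: apply
  \<open>primitive_bound\<close> with \<open>m = 0\<close> to a difference. Choosing it gives an
  operator that can be iterated.\<close>

definition decaying_primitive :: "(complex \<Rightarrow> complex) \<Rightarrow> complex \<Rightarrow> complex" where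
  "decaying_primitive f = (SOME F. (\<forall>t\<in>S. (F has_field_derivative f t) (at t)) \<and> (\<exists>C. \<forall>t\<in>S. norm (F t) \<le> C * weight t))"

lemma decaying_primitive:
  assumes "f holomorphic_on S" "\<And>t. t \<in> S \<Longrightarrow> norm (f t) \<le> m * weight t"
  shows decaying_primitive_deriv: "\<And>t. t \<in> S \<Longrightarrow> (decaying_primitive f has_field_derivative f t) (at t)"
    and decaying_primitive_bound: "\<And>t. t \<in> S \<Longrightarrow> norm (decaying_primitive f t) \<le> gain * m * weight t"
    and decaying_primitive_holomorphic: "decaying_primitive f holomorphic_on S"
proof -
  have *: "(\<forall>t\<in>S. (decaying_primitive f has_field_derivative f t) (at t)) \<and> (\<exists>C. \<forall>t\<in>S. norm (decaying_primitive f t) \<le> C * weight t)"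
    unfolding decaying_primitive_def by (rule someI_ex[OF decaying_primitive_exists[OF assms]])
  then obtain C where C: "\<And>t. t \<in> S \<Longrightarrow> norm (decaying_primitive f t) \<le> C * weight t" by blast
  show d: "\<And>t. t \<in> S \<Longrightarrow> (decaying_primitive f has_field_derivative f t) (at t)" using * by blast
  show "\<And>t. t \<in> S \<Longrightarrow> norm (decaying_primitive f t) \<le> gain * m * weight t"
    by (rule primitive_bound[OF d assms(2) C])
  show "decaying_primitive f holomorphic_on S"
    using d open_S by (auto simp: holomorphic_on_open)
qed

text \<open>The difference of the primitives decays too, so \<open>primitive_bound\<close> replaces
  the crude constants by \<open>d\<close>. This is the Lipschitz estimate for the Picard
  operator.\<close>

lemma decaying_primitive_diff_bound:
  assumes f: "f holomorphic_on S" "\<And>t. t \<in> S \<Longrightarrow> norm (f t) \<le> m * weight t"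
    and g: "g holomorphic_on S" "\<And>t. t \<in> S \<Longrightarrow> norm (g t) \<le> m' * weight t"
    and fg: "\<And>t. t \<in> S \<Longrightarrow> norm (f t - g t) \<le> d * weight t" and t: "t \<in> S"
  shows "norm (decaying_primitive f t - decaying_primitive g t) \<le> gain * d * weight t"
proof (rule primitive_bound[where F = "\<lambda>t. decaying_primitive f t - decaying_primitive g t"])
  fix t assume t: "t \<in> S"
  show "((\<lambda>t. decaying_primitive f t - decaying_primitive g t) has_field_derivative f t - g t) (at t)"
    by (intro derivative_intros decaying_primitive_deriv[OF f t] decaying_primitive_deriv[OF g t])
  have "norm (decaying_primitive f t - decaying_primitive g t) \<le> gain * m * weight t + gain * m' * weight t"
    using norm_triangle_ineq4[of "decaying_primitive f t" "decaying_primitive g t"] decaying_primitive_bound[OF f t] decaying_primitive_bound[OF g t] by linarith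
  thus "norm (decaying_primitive f t - decaying_primitive g t) \<le> (gain * m + gain * m') * weight t" by (simp add: distrib_right)
qed (use fg t in auto)

end

section \<open>Fixed point of twofold integration from \<open>x = 0\<close>\<close>

section \<open>Picard iteration\<close>

text \<open>The sequence is a telescoping series dominated by a geometric one.\<close>

lemma uniform_limit_geometric:
  fixes f :: "nat \<Rightarrow> 'a \<Rightarrow> 'b :: banach"
  assumes "\<And>n x. x \<in> S \<Longrightarrow> norm (f (Suc n) x - f n x) \<le> c * (1/2)^n"
  shows "\<exists>g. uniform_limit S f g sequentially"
proof -
  have "uniform_limit S (\<lambda>n x. \<Sum>i<n. f (Suc i) x - f i x) (\<lambda>x. \<Sum>i. f (Suc i) x - f i x) sequentially"
    by (rule Weierstrass_m_test[where M = "\<lambda>n. c * (1/2)^n"])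
       (use assms in \<open>auto intro!: summable_mult summable_geometric\<close>)
  hence "uniform_limit S (\<lambda>n x. (\<Sum>i<n. f (Suc i) x - f i x) + f 0 x)
      (\<lambda>x. (\<Sum>i. f (Suc i) x - f i x) + f 0 x) sequentially"
    by (intro uniform_limit_add uniform_limit_const)
  moreover have "(\<Sum>i<n. f (Suc i) x - f i x) + f 0 x = f n x" for n x
    using sum_lessThan_telescope[of "\<lambda>i. f i x" n] by simp
  ultimately show ?thesis by auto
qed

context contracting_domain
begin

text \<open>A solution of \<open>p'' = G (t, p, p')\<close> is a fixed point of \<open>T\<close>,
  and \<open>small\<close> makes \<open>T\<close> contract by 1/2 in the norm weighted by
  \<open>weight\<close>. Hypothesis \<open>hol\<close> speaks only of compositions with holomorphic
  \<open>p\<close>, \<open>q\<close>, which avoids holomorphy in several variables.\<close>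

lemma second_order_solution:
  fixes G :: "complex \<Rightarrow> complex \<Rightarrow> complex \<Rightarrow> complex"
  assumes hol: "\<And>p q. p holomorphic_on S \<Longrightarrow> q holomorphic_on S \<Longrightarrow>
      \<forall>t\<in>S. norm (p t) \<le> 1 \<and> norm (q t) \<le> 1 \<Longrightarrow> (\<lambda>t. G t (p t) (q t)) holomorphic_on S"
    and bnd: "\<And>t u v. t \<in> S \<Longrightarrow> norm u \<le> 1 \<Longrightarrow> norm v \<le> 1 \<Longrightarrow> norm (G t u v) \<le> M * weight t"
    and lip: "\<And>t u v u' v'. t \<in> S \<Longrightarrow> norm u \<le> 1 \<Longrightarrow> norm v \<le> 1 \<Longrightarrow> norm u' \<le> 1 \<Longrightarrow> norm v' \<le> 1 \<Longrightarrow>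
      norm (G t u v - G t u' v') \<le> M * weight t * (norm (u - u') + norm (v - v'))"
    and M: "0 \<le> M"
    and small: "\<And>t. t \<in> S \<Longrightarrow> M * weight t \<le> e" "(gain + gain^2) * e \<le> 1/2" "\<And>t. t \<in> S \<Longrightarrow> weight t \<le> 1"
  shows "\<exists>p q. \<forall>t\<in>S. (p has_field_derivative q t) (at t) \<and>
      (q has_field_derivative G t (p t) (q t)) (at t) \<and>
      norm (p t) \<le> (gain + gain^2) * M * weight t \<and> norm (p t) \<le> 1 \<and> norm (q t) \<le> 1"
proof -
  \<comment> \<open>\<open>N\<close> dominates \<open>gain * M\<close> and
    \<open>gain^2 * M\<close>, the bounds after one and after two integrations.\<close>
  define N where "N = (gain + gain^2) * M"
  define g where "g = (\<lambda>w t. G t (fst w t) (snd w t))"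
  define T where "T = (\<lambda>w. (decaying_primitive (decaying_primitive (g w)), decaying_primitive (g w)))"
  define W where "W = (\<lambda>n. (T ^^ n) (\<lambda>_. 0, \<lambda>_. 0))"
  \<comment> \<open>The invariant of the iteration; by \<open>N1\<close> it keeps both components in
    the unit ball, where \<open>bnd\<close> and \<open>lip\<close> apply.\<close>
  define I where "I = (\<lambda>w. fst w holomorphic_on S \<and> snd w holomorphic_on S \<and>
      (\<forall>t\<in>S. norm (fst w t) \<le> N * weight t \<and> norm (snd w t) \<le> N * weight t))"
  have N0: "0 \<le> N" using M by (simp add: N_def)
  have W0: "W 0 = (\<lambda>_. 0, \<lambda>_. 0)" and WS: "W (Suc n) = T (W n)" for n
    by (simp_all add: W_def)
  have N1: "N * weight t \<le> 1" if "t \<in> S" for t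
  proof -
    have "N * weight t = (gain + gain^2) * (M * weight t)" by (simp add: N_def)
    also have "\<dots> \<le> (gain + gain^2) * e" using small(1)[OF that] by (intro mult_left_mono) auto
    finally show ?thesis using small(2) by linarith
  qed
  have I1: "norm (fst w t) \<le> 1" "norm (snd w t) \<le> 1" if "I w" "t \<in> S" for w t
    using that N1[of t] by (auto simp: I_def intro: order_trans)
  have ghol: "g w holomorphic_on S" if "I w" for w
    unfolding g_def using that I1[OF that] by (intro hol) (auto simp: I_def)
  have gbnd: "norm (g w t) \<le> M * weight t" if "I w" "t \<in> S" for w t
    unfolding g_def using that by (intro bnd I1)
  have bM: "gain * M \<le> N" "gain * (gain * M) \<le> N"
    using M by (auto simp: N_def distrib_right power2_eq_square)
  have P: "decaying_primitive (g w) holomorphic_on S" if "I w" for w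
    by (rule decaying_primitive_holomorphic[OF ghol gbnd]) (use that in auto)
  have Pb: "norm (decaying_primitive (g w) t) \<le> gain * M * weight t" if "I w" "t \<in> S" for w t
    by (rule decaying_primitive_bound[OF ghol gbnd]) (use that in auto)
  have Q: "decaying_primitive (decaying_primitive (g w)) holomorphic_on S" if "I w" for w
    by (rule decaying_primitive_holomorphic[OF P Pb]) (use that in auto)
  have Qb: "norm (decaying_primitive (decaying_primitive (g w)) t) \<le> gain * (gain * M) * weight t" if "I w" "t \<in> S" for w t
    by (rule decaying_primitive_bound[OF P Pb]) (use that in auto)
  have T: "I (T w)" if w: "I w" for w
  proof -
    have "norm (decaying_primitive (g w) t) \<le> N * weight t" if "t \<in> S" for t
      by (rule order_trans[OF Pb[OF w that] mult_right_mono]) (use bM in auto)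
    moreover have "norm (decaying_primitive (decaying_primitive (g w)) t) \<le> N * weight t" if "t \<in> S" for t
      by (rule order_trans[OF Qb[OF w that] mult_right_mono]) (use bM in auto)
    ultimately show ?thesis using P[OF w] Q[OF w] by (simp add: I_def T_def)
  qed
  have IW: "I (W n)" for n
  proof (induction n)
    case 0 show ?case using N0 by (simp add: W0 I_def)
  qed (simp add: WS T)
  \<comment> \<open>Each integration costs a factor \<open>gain\<close>, so the two components
    together contract by \<open>(gain + gain^2) * e \<le> 1/2\<close>.\<close>
  have dT: "norm (fst (T w) t - fst (T w') t) + norm (snd (T w) t - snd (T w') t) \<le> d / 2 * weight t"
    if w: "I w" "I w'" and d: "\<And>t. t \<in> S \<Longrightarrow> norm (fst w t - fst w' t) + norm (snd w t - snd w' t) \<le> d * weight t"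
      and t: "t \<in> S" for w w' d t
  proof -
    have d0: "0 \<le> d" 
    proof (rule weighted_bound_nonneg)
      show "norm (fst w t - fst w' t) \<le> d * weight t" using d[OF t] by (smt (verit) norm_ge_zero)
    qed
    have gd: "norm (g w t - g w' t) \<le> (e * d) * weight t" if t: "t \<in> S" for t
    proof -
      have "norm (g w t - g w' t) \<le> M * weight t * (norm (fst w t - fst w' t) + norm (snd w t - snd w' t))"
        unfolding g_def by (intro lip I1 w t)
      also have "\<dots> \<le> e * (d * weight t)"
        using small(1)[OF t] d[OF t] M order_trans[OF _ small(1)[OF t], of 0]
        by (intro mult_mono) auto
      finally show ?thesis by (simp add: mult.assoc)
    qed
    have 1: "norm (decaying_primitive (g w) t - decaying_primitive (g w') t) \<le> gain * (e * d) * weight t" if "t \<in> S" for t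
      by (rule decaying_primitive_diff_bound[OF ghol gbnd ghol gbnd gd]) (use w that in auto)
    have 2: "norm (decaying_primitive (decaying_primitive (g w)) t - decaying_primitive (decaying_primitive (g w')) t) \<le> gain * (gain * (e * d)) * weight t"
      by (rule decaying_primitive_diff_bound[OF P Pb P Pb 1]) (use w t in auto)
    have "gain * (gain * (e * d)) * weight t + gain * (e * d) * weight t = ((gain + gain^2) * e) * (d * weight t)"
      by (simp add: algebra_simps power2_eq_square)
    also have "\<dots> \<le> 1/2 * (d * weight t)"
      using small(2) d0 by (intro mult_right_mono) auto
    finally show ?thesis using 1[OF t] 2 by (simp add: T_def)
  qed
  \<comment> \<open>The factor 2 counts components: the iteration starts at zero, so the first
    increment is \<open>W (Suc 0)\<close> itself.\<close>
  have dW: "norm (fst (W (Suc n)) t - fst (W n) t) + norm (snd (W (Suc n)) t - snd (W n) t) \<le> 2 * N * (1/2)^n * weight t"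
    if "t \<in> S" for n t using that
  proof (induction n arbitrary: t)
    case 0
    have "norm (fst (W (Suc 0)) t) \<le> N * weight t" "norm (snd (W (Suc 0)) t) \<le> N * weight t"
      using IW[of "Suc 0"] 0 by (auto simp: I_def)
    thus ?case by (simp add: W0)
  next
    case (Suc n)
    have "norm (fst (T (W (Suc n))) t - fst (T (W n)) t) + norm (snd (T (W (Suc n))) t - snd (T (W n)) t)
        \<le> 2 * N * (1/2)^n / 2 * weight t"
      by (rule dT[OF IW IW _ Suc.prems]) (rule Suc.IH)
    thus ?case by (simp add: WS)
  qed
  have dW1: "norm (fst (W (Suc n)) t - fst (W n) t) \<le> 2 * N * (1/2)^n"
    "norm (snd (W (Suc n)) t - snd (W n) t) \<le> 2 * N * (1/2)^n" if "t \<in> S" for n t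
  proof -
    have "2 * N * (1/2)^n * weight t \<le> 2 * N * (1/2)^n * 1"
      using small(3)[OF that] N0 by (intro mult_left_mono) auto
    thus "norm (fst (W (Suc n)) t - fst (W n) t) \<le> 2 * N * (1/2)^n"
      "norm (snd (W (Suc n)) t - snd (W n) t) \<le> 2 * N * (1/2)^n"
      using dW[OF that, of n] norm_ge_zero[of "fst (W (Suc n)) t - fst (W n) t"]
        norm_ge_zero[of "snd (W (Suc n)) t - snd (W n) t"] by linarith+
  qed
  obtain p where p: "uniform_limit S (\<lambda>n. fst (W n)) p sequentially"
    using uniform_limit_geometric[of S "\<lambda>n. fst (W n)", OF dW1(1)] by blast
  obtain q where q: "uniform_limit S (\<lambda>n. snd (W n)) q sequentially"
    using uniform_limit_geometric[of S "\<lambda>n. snd (W n)", OF dW1(2)] by blast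
  have limp: "(\<lambda>n. fst (W n) t) \<longlonglongrightarrow> p t" and limq: "(\<lambda>n. snd (W n) t) \<longlonglongrightarrow> q t" if "t \<in> S" for t
    using tendsto_uniform_limitI[OF p that] tendsto_uniform_limitI[OF q that] by auto
  have pN: "norm (p t) \<le> N * weight t" and qN: "norm (q t) \<le> N * weight t" if "t \<in> S" for t
    using IW that
    by (auto simp: I_def intro!: LIMSEQ_le_const2[OF tendsto_norm[OF limp]]
        LIMSEQ_le_const2[OF tendsto_norm[OF limq]])
  have pq1: "norm (p t) \<le> 1" "norm (q t) \<le> 1" if "t \<in> S" for t
    using pN[OF that] qN[OF that] N1[OF that] by linarith+
  \<comment> \<open>Holomorphic functions converging locally uniformly may be differentiated
    termwise; uniqueness of limits identifies the derivative with \<open>D\<close>.\<close>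
  have deriv: "(h has_field_derivative D t) (at t)"
    if f: "\<And>n t. t \<in> S \<Longrightarrow> (f n has_field_derivative f' n t) (at t)"
      and u: "uniform_limit S f h sequentially"
      and D: "\<And>t. t \<in> S \<Longrightarrow> (\<lambda>n. f' n t) \<longlonglongrightarrow> D t" and t: "t \<in> S" for f f' h D t
  proof -
    have u': "\<exists>d. 0 < d \<and> cball x d \<subseteq> S \<and> uniform_limit (cball x d) f h sequentially" if x: "x \<in> S" for x
    proof -
      obtain d where "0 < d" "cball x d \<subseteq> S" using open_S x open_contains_cball by metis
      thus ?thesis using uniform_limit_on_subset[OF u] by blast
    qed
    have "\<exists>h'. \<forall>x\<in>S. (h has_field_derivative h' x) (at x) \<and> (\<lambda>n. f' n x) \<longlonglongrightarrow> h' x"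
      by (rule has_complex_derivative_uniform_sequence[OF open_S _ u']) (rule f)
    then obtain h' where "(h has_field_derivative h' t) (at t)" "(\<lambda>n. f' n t) \<longlonglongrightarrow> h' t"
      using t by auto
    thus ?thesis using LIMSEQ_unique[of "\<lambda>n. f' n t" "h' t" "D t"] D[OF t] by simp
  qed
  \<comment> \<open>From index \<open>Suc n\<close> on the iterates are values of \<open>T\<close>,
    and their components have derivatives \<open>snd (W (Suc n))\<close> and
    \<open>g (W n)\<close>.\<close>
  have shiftu: "uniform_limit S (\<lambda>n. f (Suc n)) h sequentially"
    if "uniform_limit S f h sequentially" for f and h :: "complex \<Rightarrow> complex"
    using that by (rule filterlim_compose[OF _ filterlim_Suc])
  have "(p has_field_derivative q t) (at t)" if "t \<in> S" for t
  proof (rule deriv[OF _ shiftu[OF p] _ that])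
    fix n t assume t: "t \<in> S"
    show "(fst (W (Suc n)) has_field_derivative snd (W (Suc n)) t) (at t)"
      unfolding WS T_def fst_conv snd_conv by (rule decaying_primitive_deriv[OF P[OF IW] Pb[OF IW] t])
  qed (rule LIMSEQ_Suc[OF limq])
  moreover have "(q has_field_derivative G t (p t) (q t)) (at t)" if "t \<in> S" for t
  proof (rule deriv[OF _ shiftu[OF q] _ that])
    fix n t assume t: "t \<in> S"
    show "(snd (W (Suc n)) has_field_derivative g (W n) t) (at t)"
      unfolding WS T_def fst_conv snd_conv by (rule decaying_primitive_deriv[OF ghol[OF IW] gbnd[OF IW] t])
  next
    fix t assume t: "t \<in> S"
    have "(\<lambda>n. M * weight t * (norm (fst (W n) t - p t) + norm (snd (W n) t - q t))) \<longlonglongrightarrow>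
        M * weight t * (norm (p t - p t) + norm (q t - q t))"
      by (intro tendsto_intros limp limq t)
    hence "(\<lambda>n. M * weight t * (norm (fst (W n) t - p t) + norm (snd (W n) t - q t))) \<longlonglongrightarrow> 0" by simp
    moreover have "norm (g (W n) t - G t (p t) (q t)) \<le> M * weight t * (norm (fst (W n) t - p t) + norm (snd (W n) t - q t))" for n
      unfolding g_def by (intro lip I1 IW pq1 t)
    ultimately have "(\<lambda>n. g (W n) t - G t (p t) (q t)) \<longlonglongrightarrow> 0"
      by (rule Lim_null_comparison[OF always_eventually[OF allI], rotated])
    thus "(\<lambda>n. g (W n) t) \<longlonglongrightarrow> G t (p t) (q t)" by (rule LIM_zero_cancel)
  qed
  ultimately show ?thesis using pN pq1 unfolding N_def
    by (intro exI[of _ p] exI[of _ q] ballI conjI)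
qed

end

section \<open>A calculus for bounding the right-hand side\<close>

section \<open>Weighted Lipschitz bounds\<close>

text \<open>The unit balls are where the Picard iterates live. The weight \<open>h\<close> enters
  both the size and the Lipschitz constant, so a factor \<open>|x|^k\<close> makes both small at
  once.\<close>

definition lip_bound :: "real \<Rightarrow> complex set \<Rightarrow> (complex \<Rightarrow> real) \<Rightarrow> (complex \<Rightarrow> complex \<Rightarrow> complex \<Rightarrow> complex) \<Rightarrow> bool" where
  "lip_bound M S h f \<longleftrightarrow> 0 \<le> M \<and> (\<forall>t\<in>S. 0 \<le> h t) \<and>
     (\<forall>t\<in>S. \<forall>u\<in>cball 0 1. \<forall>v\<in>cball 0 1. norm (f t u v) \<le> M * h t) \<and>
     (\<forall>t\<in>S. \<forall>u\<in>cball 0 1. \<forall>v\<in>cball 0 1. \<forall>u'\<in>cball 0 1. \<forall>v'\<in>cball 0 1.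
        norm (f t u v - f t u' v') \<le> M * h t * (norm (u - u') + norm (v - v')))"

lemma lip_boundD:
  assumes "lip_bound M S h f"
  shows "0 \<le> M" "\<And>t. t \<in> S \<Longrightarrow> 0 \<le> h t"
    "\<And>t u v. t \<in> S \<Longrightarrow> norm u \<le> 1 \<Longrightarrow> norm v \<le> 1 \<Longrightarrow> norm (f t u v) \<le> M * h t"
    "\<And>t u v u' v'. t \<in> S \<Longrightarrow> norm u \<le> 1 \<Longrightarrow> norm v \<le> 1 \<Longrightarrow> norm u' \<le> 1 \<Longrightarrow> norm v' \<le> 1 \<Longrightarrow>
      norm (f t u v - f t u' v') \<le> M * h t * (norm (u - u') + norm (v - v'))"
  using assms by (auto simp: lip_bound_def)

definition weighted_lipschitz :: "complex set \<Rightarrow> (complex \<Rightarrow> real) \<Rightarrow> (complex \<Rightarrow> complex \<Rightarrow> complex \<Rightarrow> complex) \<Rightarrow> bool" where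
  "weighted_lipschitz S h f \<longleftrightarrow> (\<exists>M. lip_bound M S h f)"

lemma weighted_lipschitzI:
  assumes "\<And>t. t \<in> S \<Longrightarrow> 0 \<le> h t" "0 \<le> A" "0 \<le> B"
    and "\<And>t u v. t \<in> S \<Longrightarrow> norm u \<le> 1 \<Longrightarrow> norm v \<le> 1 \<Longrightarrow> norm (f t u v) \<le> A * h t"
    and "\<And>t u v u' v'. t \<in> S \<Longrightarrow> norm u \<le> 1 \<Longrightarrow> norm v \<le> 1 \<Longrightarrow> norm u' \<le> 1 \<Longrightarrow> norm v' \<le> 1 \<Longrightarrow>
      norm (f t u v - f t u' v') \<le> B * h t * (norm (u - u') + norm (v - v'))"
  shows "weighted_lipschitz S h f"
  unfolding weighted_lipschitz_def lip_bound_def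
proof (intro exI[of _ "max A B"] conjI ballI)
  fix t u v assume t: "t \<in> S" and uv: "u \<in> cball (0::complex) 1" "v \<in> cball (0::complex) 1"
  show "norm (f t u v) \<le> max A B * h t"
    by (rule order_trans[OF assms(4) mult_right_mono]) (use assms(1) t uv in auto)
  fix u' v' assume uv': "u' \<in> cball (0::complex) 1" "v' \<in> cball (0::complex) 1"
  show "norm (f t u v - f t u' v') \<le> max A B * h t * (norm (u - u') + norm (v - v'))"
    by (rule order_trans[OF assms(5)]) (use assms(1) t uv uv' in \<open>auto intro!: mult_right_mono\<close>)
qed (use assms in auto)

lemma weighted_lipschitz_const:
  assumes "\<And>t. t \<in> S \<Longrightarrow> 0 \<le> h t" "\<And>t. t \<in> S \<Longrightarrow> norm (c t) \<le> C * h t"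
  shows "weighted_lipschitz S h (\<lambda>t u v. c t)"
proof (rule weighted_lipschitzI[where A = "max C 0" and B = 0])
  show "norm (c t) \<le> max C 0 * h t" if "t \<in> S" for t
    by (rule order_trans[OF assms(2)[OF that] mult_right_mono]) (use assms(1) that in auto)
qed (use assms in auto)

lemma weighted_lipschitz_add:
  assumes "weighted_lipschitz S h f" "weighted_lipschitz S h g"
  shows "weighted_lipschitz S h (\<lambda>t u v. f t u v + g t u v)"
proof -
  obtain A where "lip_bound A S h f" using assms(1) by (auto simp: weighted_lipschitz_def)
  note A = lip_boundD[OF this]
  obtain B where "lip_bound B S h g" using assms(2) by (auto simp: weighted_lipschitz_def)
  note B = lip_boundD[OF this]
  show ?thesis
  proof (rule weighted_lipschitzI[where A = "A + B" and B = "A + B"])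
    fix t u v u' v' :: complex
    assume *: "t \<in> S" "norm u \<le> 1" "norm v \<le> 1" 
    show "norm (f t u v + g t u v) \<le> (A + B) * h t"
      using norm_triangle_mono[OF A(3)[OF *] B(3)[OF *]] by (simp add: distrib_right)
    assume **: "norm u' \<le> 1" "norm v' \<le> 1"
    have "f t u v + g t u v - (f t u' v' + g t u' v') = (f t u v - f t u' v') + (g t u v - g t u' v')"
      by simp
    thus "norm (f t u v + g t u v - (f t u' v' + g t u' v')) \<le> (A + B) * h t * (norm (u - u') + norm (v - v'))"
      using norm_triangle_mono[OF A(4)[OF * **] B(4)[OF * **]] by (simp only: distrib_right)
  qed (use A B in auto)
qed

text \<open>One factor carries the weight, the other is only bounded; splitting the difference of
  products as in the product rule gives twice \<open>A * B\<close>.\<close>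

lemma weighted_lipschitz_mult:
  assumes "weighted_lipschitz S h f" "weighted_lipschitz S (\<lambda>_. 1) g"
  shows "weighted_lipschitz S h (\<lambda>t u v. f t u v * g t u v)"
proof -
  obtain A where "lip_bound A S h f" using assms(1) by (auto simp: weighted_lipschitz_def)
  note A = lip_boundD[OF this]
  obtain B where "lip_bound B S (\<lambda>_. 1) g" using assms(2) by (auto simp: weighted_lipschitz_def)
  note B' = lip_boundD[OF this]
  note B = B'(1) B'(3,4)[unfolded mult_1_right]
  show ?thesis
  proof (rule weighted_lipschitzI[where A = "A * B" and B = "A * B + A * B"])
    fix t u v u' v' :: complex
    assume *: "t \<in> S" "norm u \<le> 1" "norm v \<le> 1" 
    have "norm (f t u v * g t u v) \<le> (A * h t) * B"
      unfolding norm_mult using A(1,2) * by (intro mult_mono A(3) B(2)) auto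
    thus "norm (f t u v * g t u v) \<le> (A * B) * h t" by (simp add: mult_ac)
    assume **: "norm u' \<le> 1" "norm v' \<le> 1"
    define d where "d = norm (u - u') + norm (v - v')"
    have d0: "0 \<le> d" by (simp add: d_def)
    have "norm ((f t u v - f t u' v') * g t u v) \<le> (A * h t * d) * B"
      unfolding norm_mult d_def using A(1,2) * ** by (intro mult_mono A(4) B(2)) auto
    moreover have "norm (f t u' v' * (g t u v - g t u' v')) \<le> (A * h t) * (B * d)"
      unfolding norm_mult d_def using A(1,2) * ** by (intro mult_mono A(3) B(3)) auto
    moreover have "f t u v * g t u v - f t u' v' * g t u' v'
      = (f t u v - f t u' v') * g t u v + f t u' v' * (g t u v - g t u' v')"
      by (simp add: algebra_simps)
    ultimately have "norm (f t u v * g t u v - f t u' v' * g t u' v') \<le> (A * h t * d) * B + (A * h t) * (B * d)"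
      using norm_triangle_mono by metis
    thus "norm (f t u v * g t u v - f t u' v' * g t u' v') \<le> (A * B + A * B) * h t * (norm (u - u') + norm (v - v'))"
      unfolding d_def[symmetric] by (simp add: algebra_simps)
  qed (use A B in auto)
qed

text \<open>The difference of two reciprocals is the difference of the values divided by their
  product, and \<open>c\<close> bounds that product from below.\<close>

lemma weighted_lipschitz_inverse:
  assumes "weighted_lipschitz S (\<lambda>_. 1) f" and c: "0 < c"
    "\<And>t u v. t \<in> S \<Longrightarrow> norm u \<le> 1 \<Longrightarrow> norm v \<le> 1 \<Longrightarrow> c \<le> norm (f t u v)"
  shows "weighted_lipschitz S (\<lambda>_. 1) (\<lambda>t u v. inverse (f t u v))"
proof -
  obtain A where "lip_bound A S (\<lambda>_. 1) f" using assms(1) by (auto simp: weighted_lipschitz_def)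
  note A' = lip_boundD[OF this]
  note A = A'(1) A'(4)[unfolded mult_1_right]
  have inv: "norm (inverse (f t u v)) \<le> inverse c" if "t \<in> S" "norm u \<le> 1" "norm v \<le> 1" for t u v
    unfolding norm_inverse using c(1) c(2)[OF that] by (rule le_imp_inverse_le[rotated])
  have nz: "f t u v \<noteq> 0" if "t \<in> S" "norm u \<le> 1" "norm v \<le> 1" for t u v
    using c(1) c(2)[OF that] by auto
  show ?thesis
  proof (rule weighted_lipschitzI[where A = "inverse c" and B = "inverse c * A * inverse c"])
    fix t u v u' v' :: complex
    assume *: "t \<in> S" "norm u \<le> 1" "norm v \<le> 1" 
    show "norm (inverse (f t u v)) \<le> inverse c * 1" using inv[OF *] by simp
    assume **: "norm u' \<le> 1" "norm v' \<le> 1"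
    define d where "d = norm (u - u') + norm (v - v')"
    have d0: "0 \<le> d" by (simp add: d_def)
    have "norm (inverse (f t u v) * (f t u' v' - f t u v) * inverse (f t u' v'))
        \<le> inverse c * (A * d) * inverse c"
      unfolding norm_mult using A(2)[OF * **] inv[OF *] inv[OF *(1) **] c(1) A(1) d0
      by (intro mult_mono) (auto simp: d_def norm_minus_commute)
    moreover have "inverse (f t u v) - inverse (f t u' v')
       = inverse (f t u v) * (f t u' v' - f t u v) * inverse (f t u' v')"
      using nz[OF *] nz[OF *(1) **] by (simp add: field_simps)
    ultimately show "norm (inverse (f t u v) - inverse (f t u' v'))
        \<le> inverse c * A * inverse c * 1 * (norm (u - u') + norm (v - v'))"
      unfolding d_def[symmetric] by (simp add: mult_ac)
  qed (use A c in auto)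
qed

text \<open>Its use is to pass from a weight \<open>h \<le> 1\<close> to the weight 1, as the second
  factor in \<open>weighted_lipschitz_mult\<close> requires.\<close>

lemma weighted_lipschitz_mono:
  assumes "weighted_lipschitz S h f" "\<And>t. t \<in> S \<Longrightarrow> h t \<le> h' t"
  shows "weighted_lipschitz S h' f"
proof -
  obtain A where "lip_bound A S h f" using assms(1) by (auto simp: weighted_lipschitz_def)
  note A = lip_boundD[OF this]
  show ?thesis
  proof (rule weighted_lipschitzI[where A = A and B = A])
    fix t u v u' v' :: complex
    assume *: "t \<in> S" 
    have h: "A * h t \<le> A * h' t" using A(1) assms(2)[OF *] by (rule mult_left_mono[rotated])
    show "0 \<le> h' t" using A(2) assms(2) * order_trans by blast
    assume **: "norm u \<le> 1" "norm v \<le> 1"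
    show "norm (f t u v) \<le> A * h' t" using A(3)[OF * **] h by linarith
    assume ***: "norm u' \<le> 1" "norm v' \<le> 1"
    show "norm (f t u v - f t u' v') \<le> A * h' t * (norm (u - u') + norm (v - v'))"
      by (rule order_trans[OF A(4)[OF * ** ***] mult_right_mono[OF h]]) simp
  qed (use A in auto)
qed

lemma weighted_lipschitz_snd: "weighted_lipschitz S (\<lambda>_. 1) (\<lambda>t u v. v)"
  by (rule weighted_lipschitzI[where A = 1 and B = 1]) auto

lemma norm_exp_le_of_norm_le_one:
  fixes z :: complex
  assumes "norm z \<le> 1"
  shows "norm (exp z) \<le> exp 1"
  using complex_Re_le_cmod[of z] assms by simp

lemma norm_exp_diff_le:
  fixes z w :: complex
  assumes "norm z \<le> 1" "norm w \<le> 1"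
  shows "norm (exp z - exp w) \<le> exp 1 * norm (z - w)"
proof (rule field_differentiable_bound[where S = "cball 0 1" and f' = exp])
  show "(exp has_field_derivative exp z) (at z within cball 0 1)" for z :: complex
    by (auto intro!: derivative_eq_intros)
qed (use assms norm_exp_le_of_norm_le_one in auto)

text \<open>The values \<open>s = 1\<close> and \<open>s = -1\<close> serve for \<open>exp u\<close>
  and \<open>exp (- u)\<close> in \<open>PVI_m\<close> and \<open>PVI_y\<close>.\<close>

lemma weighted_lipschitz_exp:
  assumes s: "norm (s :: complex) = 1"
  shows "weighted_lipschitz S (\<lambda>_. 1) (\<lambda>t u v. exp (s * u))"
proof (rule weighted_lipschitzI[where A = "exp 1" and B = "exp 1"])
  fix t u v u' v' :: complex
  assume u: "norm u \<le> 1"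
  show "norm (exp (s * u)) \<le> exp 1 * 1"
    using norm_exp_le_of_norm_le_one[of "s * u"] u s by (simp add: norm_mult)
  assume u': "norm u' \<le> 1"
  have "norm (exp (s * u) - exp (s * u')) \<le> exp 1 * norm (s * u - s * u')"
    by (rule norm_exp_diff_le) (use u u' s in \<open>auto simp: norm_mult\<close>)
  also have "norm (s * u - s * u') = norm (u - u')"
    using s by (simp add: norm_mult flip: right_diff_distrib)
  also have "exp 1 * norm (u - u') \<le> exp 1 * 1 * (norm (u - u') + norm (v - v'))" by simp
  finally show "norm (exp (s * u) - exp (s * u')) \<le> exp 1 * 1 * (norm (u - u') + norm (v - v'))" .
qed auto

section \<open>Algebra of the substitution \<open>y = x (cosh (v / 2))^2\<close>\<close>

section \<open>The equation in the logarithmic variable\<close>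

text \<open>
  Here \<open>y = x (cosh (v / 2))^2\<close>, \<open>m = x sinh v / 2\<close>, and \<open>w1\<close>, \<open>w2\<close> are the first two derivatives of
  \<open>v\<close> with respect to \<open>log x\<close>; the other two arguments are the resulting \<open>dy/dx\<close> and \<open>d^2y/dx^2\<close>.
\<close>

lemma PVI_cleared_cosh:
  fixes x y m w1 w2 \<mu> :: complex
  assumes nz: "x \<noteq> 0" "x \<noteq> 1" "y \<noteq> 1"
    and ym: "y * (y - x) = m^2"
    and w2: "w2 = - m / (2 * (y-1) * (x-1)) + y * w1 / (y-1) + m * w1^2 / (2 * (y-1))
      - x * w1 / (x-1) + (2*\<mu>-1)^2 * m * (y-1) / (2 * (x-1)^2)"
  shows "PVI_cleared \<mu> x y ((y + m * w1) / x) ((m * w2 + w1 * m + w1^2 * (y - x/2)) / x^2)"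
proof -
  define k where "k = (2*\<mu>-1)^2"
  have nz': "y - 1 \<noteq> 0" "x - 1 \<noteq> 0" using nz by auto
  have e: "2 * (y-1) * (x-1)^2 * w2 = - m * (x-1) + 2 * y * w1 * (x-1)^2 + m * w1^2 * (x-1)^2
      - 2 * x * w1 * (x-1) * (y-1) + k * m * (y-1)^2"
    unfolding w2 k_def[symmetric] using nz' 
    by (simp add: divide_simps) (simp add: algebra_simps power2_eq_square)
  \<comment> \<open>This is the equation times \<open>2 * x^2 * (x-1)^2\<close>. It is a polynomial
    consequence of \<open>e\<close>, which eliminates \<open>w2\<close>, and \<open>ym\<close>,
    which eliminates even powers of \<open>m\<close>.\<close>
  have poly: "2 * (x-1)^2 * y * (y-1) * (y-x) * (m * w2 + w1 * m + w1^2 * (y - x/2)) =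
     (x-1)^2 * ((y-1)*(y-x)+y*(y-x)+y*(y-1)) * (y+m*w1)^2
     - 2 * ((x-1)*(2*x-1)*y*(y-1)*(y-x) + x*(x-1)^2*y*(y-1)) * (y+m*w1)
     + y^2*(y-1)^2*(k*(y-x)^2+x*(x-1))" (is "?L = ?R")
    using e ym by algebra
  have "2 * x^2 * (x-1)^2 * (y * (y - 1) * (y - x) * ((m * w2 + w1 * m + w1^2 * (y - x/2)) / x^2)) = ?L"
    using nz by (simp add: divide_simps)
  moreover have "2 * x^2 * (x-1)^2 * (1/2 * ((y - 1) * (y - x) + y * (y - x) + y * (y - 1)) * ((y + m * w1) / x)^2
       - ((1/x + 1/(x - 1)) * (y * (y - 1) * (y - x)) + y * (y - 1)) * ((y + m * w1) / x)
       + 1/2 * (y^2 * (y - 1)^2 / (x^2 * (x - 1)^2))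
           * (k * (y - x)^2 + x * (x - 1))) = ?R"
  proof -
    \<comment> \<open>Naming the reciprocals turns the identity into a polynomial consequence of
      \<open>XZ\<close>.\<close>
    define X where "X = 1/x" define Z where "Z = 1/(x-1)"
    have XZ: "x * X = 1" "(x-1) * Z = 1" using nz nz' by (auto simp: X_def Z_def)
    have i: "(y + m * w1) / x = (y+m*w1) * X" "y^2 * (y - 1)^2 / (x^2 * (x - 1)^2) = y^2*(y-1)^2*X^2*Z^2"
      by (auto simp: X_def Z_def power_divide)
    show ?thesis unfolding i X_def[symmetric] Z_def[symmetric] using XZ by algebra
  qed
  moreover have "2 * x^2 * (x-1)^2 \<noteq> 0" using nz by simp
  ultimately show ?thesis unfolding PVI_cleared_def k_def[symmetric] using poly
    by (metis mult_left_cancel)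
qed

text \<open>
  The quantities \<open>m\<close>, \<open>y\<close> and the right-hand side \<open>G\<close> for \<open>e^v = c x^(-\<sigma>) e^u\<close> and
  \<open>v' = w - \<sigma>\<close>, with \<open>w\<close> the last argument of \<open>PVI_G\<close>.  The terms of \<open>PVI_G\<close> are grouped as a small
  factor times a bounded one.
\<close>

definition PVI_m :: "complex \<Rightarrow> complex \<Rightarrow> complex \<Rightarrow> complex \<Rightarrow> complex" where
  "PVI_m c \<sigma> t u = (c * exp ((1 - \<sigma>) * t) * exp u - exp ((1 + \<sigma>) * t) / c * exp (- u)) / 4"

definition PVI_y :: "complex \<Rightarrow> complex \<Rightarrow> complex \<Rightarrow> complex \<Rightarrow> complex" where
  "PVI_y c \<sigma> t u = (c * exp ((1 - \<sigma>) * t) * exp u + 2 * exp t + exp ((1 + \<sigma>) * t) / c * exp (- u)) / 4"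

definition PVI_G :: "complex \<Rightarrow> complex \<Rightarrow> complex \<Rightarrow> complex \<Rightarrow> complex \<Rightarrow> complex \<Rightarrow> complex" where
  "PVI_G \<mu> c \<sigma> t u v =
     PVI_m c \<sigma> t u * (inverse (PVI_y c \<sigma> t u - 1) * (- inverse (2 * (exp t - 1))))
     + PVI_y c \<sigma> t u * ((v - \<sigma>) * inverse (PVI_y c \<sigma> t u - 1))
     + PVI_m c \<sigma> t u * ((v - \<sigma>) * (v - \<sigma>) * (inverse (PVI_y c \<sigma> t u - 1) * (1/2)))
     + exp t * ((v - \<sigma>) * (- inverse (exp t - 1)))
     + PVI_m c \<sigma> t u * ((PVI_y c \<sigma> t u - 1) * ((2*\<mu>-1)^2 * inverse (2 * (exp t - 1)^2)))"

text \<open>In exponentials this is \<open>(cosh (v/2) sinh (v/2))^2 = (sinh v)^2 / 4\<close>; the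
  terms with \<open>e^v\<close> and \<open>e^(-v)\<close> have product \<open>x^2\<close>.\<close>

lemma PVI_y_times_y_minus_x:
  assumes "c \<noteq> 0"
  shows "PVI_y c \<sigma> t u * (PVI_y c \<sigma> t u - exp t) = (PVI_m c \<sigma> t u)^2"
proof -
  define p q where "p = c * exp ((1 - \<sigma>) * t) * exp u" and "q = exp ((1 + \<sigma>) * t) / c * exp (- u)"
  have "p * q = exp ((1 - \<sigma>) * t) * exp ((1 + \<sigma>) * t) * (exp u * exp (- u))"
    using assms by (simp add: p_def q_def)
  also have "\<dots> = exp t ^ 2"
    by (simp add: power2_eq_square flip: exp_add) (simp add: algebra_simps)
  finally have pq: "p * q = exp t ^ 2" .
  have "(p + 2 * exp t + q) / 4 * ((p + 2 * exp t + q) / 4 - exp t) = ((p - q) / 4)^2"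
    using pq by (simp add: field_simps power2_eq_square)
  thus ?thesis by (simp add: PVI_y_def PVI_m_def p_def q_def)
qed

text \<open>With respect to \<open>t\<close> the derivative of \<open>y\<close> is
  \<open>y + m v'\<close> and that of \<open>m\<close> is \<open>m + (y - x/2) v'\<close>, which
  brings \<open>PVI_cleared_cosh\<close> into play. The bound 1/2 excludes \<open>y = 1\<close>, and
  \<open>Re t < 0\<close> excludes \<open>x = 1\<close>.\<close>

lemma PVI_solution_of_log_solution:
  assumes c: "c \<noteq> 0" and T: "open T" "\<And>t. t \<in> T \<Longrightarrow> Re t < 0"
    and p: "\<And>t. t \<in> T \<Longrightarrow> (p has_field_derivative q t) (at t)"
    and q: "\<And>t. t \<in> T \<Longrightarrow> (q has_field_derivative PVI_G \<mu> c \<sigma> t (p t) (q t)) (at t)"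
    and y: "\<And>t. t \<in> T \<Longrightarrow> norm (PVI_y c \<sigma> t (p t)) \<le> 1/2"
  shows "PVI_solution \<mu> (\<lambda>t. PVI_y c \<sigma> t (p t)) T"
proof -
  define Y where "Y = (\<lambda>t. PVI_y c \<sigma> t (p t))"
  define m where "m = (\<lambda>t. PVI_m c \<sigma> t (p t))"
  define w1 where "w1 = (\<lambda>t. q t - \<sigma>)"
  define w2 where "w2 = (\<lambda>t. PVI_G \<mu> c \<sigma> t (p t) (q t))"
  define D where "D = (\<lambda>t. Y t + m t * w1 t)"
  have dY: "(Y has_field_derivative D t) (at t)" if "t \<in> T" for t
    unfolding Y_def PVI_y_def D_def m_def PVI_m_def w1_def
    by (auto intro!: derivative_eq_intros p[OF that] simp: c field_simps)
  have dm: "(m has_field_derivative m t + w1 t * (Y t - exp t / 2)) (at t)" if "t \<in> T" for t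
    unfolding Y_def PVI_y_def m_def PVI_m_def w1_def
    by (auto intro!: derivative_eq_intros p[OF that] simp: c field_simps)
  have dw: "(w1 has_field_derivative w2 t) (at t)" if "t \<in> T" for t
    unfolding w1_def w2_def using q[OF that] by (auto intro!: derivative_eq_intros)
  have ddxY: "ddx Y t = D t / exp t" if "t \<in> T" for t
    using DERIV_imp_deriv[OF dY[OF that]] by (simp add: ddx_def)
  have ddxddxY: "ddx (ddx Y) t = (m t * w2 t + w1 t * m t + (w1 t)^2 * (Y t - exp t / 2)) / exp t ^ 2"
    if t: "t \<in> T" for t
  proof -
    have "((\<lambda>t. D t / exp t) has_field_derivative
        (((D t + ((m t + w1 t * (Y t - exp t / 2)) * w1 t + m t * w2 t)) * exp t - D t * exp t) / (exp t * exp t))) (at t)"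
      unfolding D_def
      by (auto intro!: derivative_eq_intros dY[OF t] dm[OF t] dw[OF t] simp: D_def algebra_simps)
    \<comment> \<open>\<open>ddx Y\<close> is known to be this quotient only on \<open>T\<close>;
      openness of \<open>T\<close> suffices for its derivative.\<close>
    hence "(ddx Y has_field_derivative
        (((D t + ((m t + w1 t * (Y t - exp t / 2)) * w1 t + m t * w2 t)) * exp t - D t * exp t) / (exp t * exp t))) (at t)"
      by (rule has_field_derivative_transform_within_open[OF _ T(1) t]) (simp add: ddxY)
    from DERIV_imp_deriv[OF this] have "deriv (ddx Y) t = ((m t + w1 t * (Y t - exp t / 2)) * w1 t + m t * w2 t) / exp t"
      by (simp add: left_diff_distrib[symmetric])
    thus ?thesis
      by (simp add: ddx_def[of "ddx Y"] power2_eq_square distrib_left distrib_right mult_ac add_ac)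
  qed
  have "Y analytic_on T"
    using dY T(1) by (auto simp: analytic_on_open holomorphic_on_open)
  moreover have "PVI_eq \<mu> (exp t) (Y t) (ddx Y t) (ddx (ddx Y) t)" if t: "t \<in> T" for t
  proof -
    have x1: "exp t \<noteq> 1"
    proof
      assume "exp t = 1"
      hence "norm (exp t) = 1" by (simp only: norm_one)
      thus False using T(2)[OF t] by simp
    qed
    have y1: "Y t \<noteq> 1" using y[OF t] by (auto simp: Y_def)
    have "w2 t = m t * (inverse (Y t - 1) * (- inverse (2 * (exp t - 1)))) + Y t * (w1 t * inverse (Y t - 1))
      + m t * (w1 t * w1 t * (inverse (Y t - 1) * (1/2))) + exp t * (w1 t * (- inverse (exp t - 1)))
      + m t * ((Y t - 1) * ((2*\<mu>-1)^2 * inverse (2 * (exp t - 1)^2)))"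
      unfolding w2_def PVI_G_def Y_def m_def w1_def by (rule refl)
    also have "\<dots> = - m t / (2 * (Y t - 1) * (exp t - 1)) + Y t * w1 t / (Y t - 1) + m t * (w1 t)^2 / (2 * (Y t - 1))
      - exp t * w1 t / (exp t - 1) + (2*\<mu>-1)^2 * m t * (Y t - 1) / (2 * (exp t - 1)^2)"
      by (simp only: divide_inverse inverse_mult_distrib power2_eq_square) (simp add: mult_ac)
    finally have w2: "w2 t = \<dots>" .
    have "PVI_cleared \<mu> (exp t) (Y t) (ddx Y t) (ddx (ddx Y) t)"
      unfolding ddxddxY[OF t] ddxY[OF t] D_def
    proof (rule PVI_cleared_cosh[OF _ x1 y1 _ w2])
      show "Y t * (Y t - exp t) = (m t)\<^sup>2"
        unfolding Y_def m_def by (rule PVI_y_times_y_minus_x[OF c])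
    qed simp
    thus ?thesis using PVI_eq_iff_cleared[OF _ x1] by simp
  qed
  ultimately show ?thesis by (simp add: PVI_solution_def Y_def)
qed

section \<open>Existence of a decaying solution near \<open>x = 0\<close>\<close>

lemma exp_small_at_minus_infinity:
  fixes k D e :: real
  assumes "0 < k" "0 < e"
  shows "\<exists>R<0. \<forall>r\<le>R. D * exp (k * r) \<le> e"
proof -
  define E where "E = max D 1"
  have E: "D \<le> E" "0 < E" by (auto simp: E_def)
  define R where "R = min (-1) (ln (e / E) / k)"
  have "D * exp (k * r) \<le> e" if "r \<le> R" for r
  proof -
    have "k * r \<le> ln (e / E)"
      using that assms by (simp add: R_def field_simps)
    hence "exp (k * r) \<le> e / E"
      using assms E by (metis divide_pos_pos exp_le_cancel_iff exp_ln)
    hence "E * exp (k * r) \<le> e" using E by (simp add: field_simps)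
    moreover have "D * exp (k * r) \<le> E * exp (k * r)" using E by (intro mult_right_mono) auto
    ultimately show ?thesis by linarith
  qed
  moreover have "R < 0" by (simp add: R_def)
  ultimately show ?thesis by blast
qed

text \<open>\<open>P\<close> and \<open>Q\<close> bound the coefficients of \<open>e^u\<close> and
  \<open>e^(-u)\<close> by \<open>|x|^k\<close>, and \<open>|x| \<le> |x|^k\<close> as
  \<open>k \<le> 1\<close>. So \<open>m\<close>, \<open>y\<close>, \<open>x\<close> carry the weight
  \<open>h\<close>; every other factor is bounded, since \<open>|y|, |x| \<le> 1/2\<close> keep
  \<open>y - 1\<close> and \<open>x - 1\<close> away from 0.\<close>

lemma weighted_lipschitz_PVI_G:
  fixes k C :: real and S :: "complex set"
  defines "h \<equiv> \<lambda>t::complex. exp (k * Re t)"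
  assumes k: "0 < k" "k \<le> 1" and c: "c \<noteq> 0" and C: "0 \<le> C"
    and P: "\<And>t. t \<in> S \<Longrightarrow> norm (c * exp ((1 - \<sigma>) * t)) \<le> C * exp (k * Re t)"
    and Q: "\<And>t. t \<in> S \<Longrightarrow> norm (exp ((1 + \<sigma>) * t) / c) \<le> C * exp (k * Re t)"
    and small: "\<And>t. t \<in> S \<Longrightarrow> Re t \<le> 0" "\<And>t. t \<in> S \<Longrightarrow> (C * exp 1 + 1) * exp (k * Re t) \<le> 1/2"
  shows "weighted_lipschitz S h (PVI_G \<mu> c \<sigma>)"
    and "\<And>t u. t \<in> S \<Longrightarrow> norm u \<le> 1 \<Longrightarrow> norm (PVI_y c \<sigma> t u) \<le> 1/2"
    and "\<And>t. t \<in> S \<Longrightarrow> norm (exp t) \<le> 1/2"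
proof -
  have h0: "0 \<le> h t" and h1: "t \<in> S \<Longrightarrow> h t \<le> 1" for t
    using small(1)[of t] k by (auto simp: h_def mult_nonneg_nonpos)
  have x: "norm (exp t) \<le> 1 * h t" if "t \<in> S" for t
  proof -
    have "Re t \<le> k * Re t" using small(1)[OF that] k mult_right_mono_neg[of k 1 "Re t"] by simp
    thus ?thesis by (simp add: h_def)
  qed
  have hs: "C * exp 1 * h t + h t \<le> 1/2" "h t \<le> 1/2" if "t \<in> S" for t
  proof -
    show "C * exp 1 * h t + h t \<le> 1/2" using small(2)[OF that] by (simp add: h_def distrib_right)
    moreover have "0 \<le> C * exp 1 * h t" using C h0 by simp
    ultimately show "h t \<le> 1/2" by linarith
  qed
  show x2: "norm (exp t) \<le> 1/2" if "t \<in> S" for t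
    using x[OF that] hs(2)[OF that] by simp
  show y2: "norm (PVI_y c \<sigma> t u) \<le> 1/2" if t: "t \<in> S" and u: "norm u \<le> 1" for t u
  proof -
    have "norm (c * exp ((1 - \<sigma>) * t) * exp u) \<le> (C * h t) * exp 1"
      unfolding norm_mult[of _ "exp u"] h_def using P[OF t] norm_exp_le_of_norm_le_one[OF u] C by (intro mult_mono) auto
    moreover have "norm (exp ((1 + \<sigma>) * t) / c * exp (- u)) \<le> (C * h t) * exp 1"
      unfolding norm_mult[of _ "exp (- u)"] h_def using Q[OF t] norm_exp_le_of_norm_le_one[of "- u"] u C by (intro mult_mono) auto
    moreover have "norm (2 * exp t) \<le> 2 * h t" using x[OF t] by simp
    ultimately have "norm (c * exp ((1 - \<sigma>) * t) * exp u + 2 * exp t + exp ((1 + \<sigma>) * t) / c * exp (- u))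
        \<le> (C * h t) * exp 1 + 2 * h t + (C * h t) * exp 1"
      by (intro norm_triangle_mono)
    also have "\<dots> \<le> 4 * (1/2)" using hs(1)[OF t] h0[of t] by (simp add: mult_ac)
    finally show ?thesis by (simp add: PVI_y_def norm_divide)
  qed
  have ix: "norm (inverse (exp t - 1)) \<le> 2" if "t \<in> S" for t
  proof -
    have "1/2 \<le> norm (exp t - 1)"
      using x2[OF that] norm_triangle_ineq2[of 1 "exp t"] by (simp add: norm_minus_commute)
    from le_imp_inverse_le[OF this] show ?thesis by (simp add: norm_inverse)
  qed
  note add = weighted_lipschitz_add and mult = weighted_lipschitz_mult
  have one: "weighted_lipschitz S (\<lambda>_. 1) (\<lambda>t u v. a)" for a
    by (rule weighted_lipschitz_const[where C = "norm a"]) auto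
  have c: "weighted_lipschitz S (\<lambda>_. 1) (\<lambda>t u v. f t)" if "\<And>t. t \<in> S \<Longrightarrow> norm (f t) \<le> B" for f B
    by (rule weighted_lipschitz_const[where C = B]) (use that in auto)
  have P': "weighted_lipschitz S h (\<lambda>t u v. c * exp ((1 - \<sigma>) * t))"
    by (rule weighted_lipschitz_const[where C = C]) (use P h0 in \<open>auto simp: h_def\<close>)
  have Q': "weighted_lipschitz S h (\<lambda>t u v. exp ((1 + \<sigma>) * t) / c)"
    by (rule weighted_lipschitz_const[where C = C]) (use Q h0 in \<open>auto simp: h_def\<close>)
  have x': "weighted_lipschitz S h (\<lambda>t u v. exp t)"
    by (rule weighted_lipschitz_const[where C = 1]) (use x h0 in auto)
  have eu: "weighted_lipschitz S (\<lambda>_. 1) (\<lambda>t u v. exp u)" "weighted_lipschitz S (\<lambda>_. 1) (\<lambda>t u v. exp (- u))"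
    using weighted_lipschitz_exp[of 1 S] weighted_lipschitz_exp[of "-1" S] by simp_all
  have m: "weighted_lipschitz S h (\<lambda>t u v. PVI_m c \<sigma> t u)"
  proof -
    have "weighted_lipschitz S h (\<lambda>t u v. (c * exp ((1 - \<sigma>) * t) * exp u + exp ((1 + \<sigma>) * t) / c * exp (- u) * (-1)) * (1/4))"
      by (intro mult add P' Q' eu one)
    thus ?thesis by (simp add: PVI_m_def)
  qed
  have y: "weighted_lipschitz S h (\<lambda>t u v. PVI_y c \<sigma> t u)"
  proof -
    have "weighted_lipschitz S h (\<lambda>t u v. (c * exp ((1 - \<sigma>) * t) * exp u + exp t * 2 + exp ((1 + \<sigma>) * t) / c * exp (- u)) * (1/4))"
      by (intro mult add P' Q' eu one x')
    thus ?thesis by (simp add: PVI_y_def mult.commute)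
  qed
  have y1: "weighted_lipschitz S (\<lambda>_. 1) (\<lambda>t u v. PVI_y c \<sigma> t u - 1)"
    using add[OF weighted_lipschitz_mono[OF y h1] one[of "-1"]] by simp
  have iy: "weighted_lipschitz S (\<lambda>_. 1) (\<lambda>t u v. inverse (PVI_y c \<sigma> t u - 1))"
  proof (rule weighted_lipschitz_inverse[OF y1, of "1/2"])
    show "1/2 \<le> norm (PVI_y c \<sigma> t u - 1)" if "t \<in> S" "norm u \<le> 1" for t u
      using y2[OF that] norm_triangle_ineq2[of 1 "PVI_y c \<sigma> t u"] by (simp add: norm_minus_commute)
  qed simp
  have v: "weighted_lipschitz S (\<lambda>_. 1) (\<lambda>t u v. v - \<sigma>)"
    using add[OF weighted_lipschitz_snd one[of "- \<sigma>"]] by simp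
  have c1: "weighted_lipschitz S (\<lambda>_. 1) (\<lambda>t u v. - inverse (exp t - 1))"
    by (rule c[of _ 2]) (use ix in simp)
  have c2: "weighted_lipschitz S (\<lambda>_. 1) (\<lambda>t u v. - inverse (2 * (exp t - 1)))"
  proof (rule c[of _ 2])
    have *: "norm (- inverse (2 * z)) \<le> 2" if "norm (inverse z) \<le> 2" for z :: complex
      using that by (simp add: norm_inverse norm_mult)
    show "norm (- inverse (2 * (exp t - 1))) \<le> 2" if "t \<in> S" for t
      by (rule *[OF ix[OF that]])
  qed
  have c3: "weighted_lipschitz S (\<lambda>_. 1) (\<lambda>t u v. (2*\<mu>-1)^2 * inverse (2 * (exp t - 1)^2))"
  proof (rule c[of _ "norm ((2*\<mu>-1)^2) * 2"])
    have *: "norm (inverse (2 * z^2)) \<le> 2" if "norm (inverse z) \<le> 2" for z :: complex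
      using power_mono[OF that, of 2] by (simp add: norm_inverse norm_mult norm_power power_inverse)
    show "norm ((2*\<mu>-1)^2 * inverse (2 * (exp t - 1)^2)) \<le> norm ((2*\<mu>-1)^2) * 2" if "t \<in> S" for t
      unfolding norm_mult[of "(2*\<mu>-1)^2"] by (intro mult_left_mono *[OF ix[OF that]]) simp
  qed
  show "weighted_lipschitz S h (PVI_G \<mu> c \<sigma>)"
    unfolding PVI_G_def by (intro add mult m y iy v x' c1 c2 c3 y1 one)
qed

text \<open>Cutting \<open>S\<close> by \<open>Re t < R\<close> keeps it a contracting domain, as
  the shift lowers \<open>Re t\<close>. \<open>R1\<close> makes the bounds on \<open>PVI_G\<close>
  available and fixes \<open>M\<close>; \<open>R2\<close> then makes \<open>M * weight\<close> small
  enough for a contraction.\<close>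

lemma PVI_log_solution:
  assumes cd: "contracting_domain S l k" and k: "k \<le> 1" and c: "c \<noteq> 0"
    and P: "\<And>t. t \<in> S \<Longrightarrow> norm (c * exp ((1 - \<sigma>) * t)) \<le> C * exp (k * Re t)"
    and Q: "\<And>t. t \<in> S \<Longrightarrow> norm (exp ((1 + \<sigma>) * t) / c) \<le> C * exp (k * Re t)"
  shows "\<exists>R<0. \<exists>p q N. \<forall>t\<in>S. Re t < R \<longrightarrow>
      (p has_field_derivative q t) (at t) \<and>
      (q has_field_derivative PVI_G \<mu> c \<sigma> t (p t) (q t)) (at t) \<and>
      norm (p t) \<le> N * exp (k * Re t) \<and> norm (p t) \<le> 1 \<and> norm (PVI_y c \<sigma> t (p t)) \<le> 1/2"
proof -
  interpret S: contracting_domain S l k by fact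
  define C' where "C' = max C 0"
  have C': "0 \<le> C'" and CC': "C * exp (k * Re t) \<le> C' * exp (k * Re t)" for t :: complex
    by (auto simp: C'_def intro: mult_right_mono)
  obtain R1 where R1: "R1 < 0" "\<And>r. r \<le> R1 \<Longrightarrow> (C' * exp 1 + 1) * exp (k * r) \<le> 1/2"
    using exp_small_at_minus_infinity[OF S.k_pos, of "1/2"] by auto
  define T where "T = (\<lambda>R. S \<inter> {t. Re t < R})"
  have T: "contracting_domain (T R) l k" for R
  proof
    show "open (T R)" unfolding T_def by (intro open_Int S.open_S open_halfspace_Re_lt)
    show "convex (T R)" unfolding T_def by (intro convex_Int S.convex_S convex_halfspace_Re_lt)
    show "t - complex_of_real u * l \<in> T R" if "t \<in> T R" "0 \<le> u" for t u
      using that S.shift S.Re_l by (auto simp: T_def)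
  qed (fact S.Re_l S.k_pos)+
  have PT: "norm (c * exp ((1 - \<sigma>) * t)) \<le> C' * exp (k * Re t)"
    and QT: "norm (exp ((1 + \<sigma>) * t) / c) \<le> C' * exp (k * Re t)" if "t \<in> T R" for t R
    using P[of t] Q[of t] CC'[of t] that by (auto simp: T_def intro: order_trans)
  have R1': "Re t \<le> 0" "(C' * exp 1 + 1) * exp (k * Re t) \<le> 1/2" if "t \<in> T R1" for t
    using R1(1) R1(2)[of "Re t"] that by (auto simp: T_def)
  note W = weighted_lipschitz_PVI_G[where S = "T R1", OF S.k_pos k c C' PT[of _ R1] QT[of _ R1] R1']
  have W1: "weighted_lipschitz (T R1) (\<lambda>t. exp (k * Re t)) (PVI_G \<mu> c \<sigma>)"
    by (rule W(1))
  have W2: "norm (PVI_y c \<sigma> t u) \<le> 1/2" if "t \<in> T R1" "norm u \<le> 1" for t u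
    by (rule W(2)) (assumption | fact that)+
  have W3: "norm (exp t) \<le> 1/2" if "t \<in> T R1" for t
    by (rule W(3)) (assumption | fact that)+
  obtain M where M: "lip_bound M (T R1) (\<lambda>t. exp (k * Re t)) (PVI_G \<mu> c \<sigma>)"
    using W1 by (auto simp: weighted_lipschitz_def)
  \<comment> \<open>This is \<open>gain + gain^2\<close>, which depends only on \<open>l\<close> and
    \<open>k\<close>, so \<open>e\<close> can be fixed before the cut \<open>R\<close>.\<close>
  define B where "B = norm l / k + (norm l / k)^2"
  have B: "0 \<le> B" using S.k_pos by (simp add: B_def)
  define e where "e = 1 / (2 * (B + 1))"
  have e: "0 < e" "B * e \<le> 1/2" using B by (auto simp: e_def field_simps)
  obtain R2 where R2: "R2 < 0" "\<And>r. r \<le> R2 \<Longrightarrow> M * exp (k * r) \<le> e"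
    using exp_small_at_minus_infinity[OF S.k_pos e(1), of M] by auto
  define R where "R = min R1 R2"
  have sub: "T R \<subseteq> T R1" by (auto simp: T_def R_def)
  interpret T: contracting_domain "T R" l k by (rule T)
  have weight: "T.weight = (\<lambda>t. exp (k * Re t))" by (simp add: T.weight_def fun_eq_iff)
  note L = lip_boundD[OF M]
  have "\<exists>p q. \<forall>t\<in>T R. (p has_field_derivative q t) (at t) \<and>
      (q has_field_derivative PVI_G \<mu> c \<sigma> t (p t) (q t)) (at t) \<and>
      norm (p t) \<le> (T.gain + T.gain^2) * M * T.weight t \<and> norm (p t) \<le> 1 \<and> norm (q t) \<le> 1"
  proof (rule T.second_order_solution[where e = e])
    fix p q assume p: "p holomorphic_on T R" and q: "q holomorphic_on T R"
      and 1: "\<forall>t\<in>T R. norm (p t) \<le> 1 \<and> norm (q t) \<le> 1"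
    have y: "PVI_y c \<sigma> t (p t) - 1 \<noteq> 0" if "t \<in> T R" for t
      using W2[of t "p t"] 1 that sub by auto
    have x: "exp t - 1 \<noteq> 0" if "t \<in> T R" for t
    proof
      assume "exp t - 1 = 0"
      hence "exp t = 1" by simp
      hence "norm (exp t) = 1" by (simp only: norm_one)
      thus False using W3[of t] that sub by auto
    qed
    have hy: "(\<lambda>t. PVI_y c \<sigma> t (p t)) holomorphic_on T R"
      and hm: "(\<lambda>t. PVI_m c \<sigma> t (p t)) holomorphic_on T R"
      unfolding PVI_y_def PVI_m_def using c by (auto intro!: holomorphic_intros p)
    show "(\<lambda>t. PVI_G \<mu> c \<sigma> t (p t) (q t)) holomorphic_on T R"
      unfolding PVI_G_def using x y by (intro holomorphic_intros hy hm q) auto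
  next
    show "(T.gain + T.gain\<^sup>2) * e \<le> 1 / 2" using e(2) by (simp add: T.gain_def B_def)
    show "T.weight t \<le> 1" if "t \<in> T R" for t
      using that R1(1) S.k_pos by (simp add: weight T_def R_def mult_nonneg_nonpos)
    show "M * T.weight t \<le> e" if "t \<in> T R" for t
      using that R2 by (simp add: weight T_def R_def)
    show "norm (PVI_G \<mu> c \<sigma> t u v) \<le> M * T.weight t" if "t \<in> T R" "norm u \<le> 1" "norm v \<le> 1" for t u v
      unfolding weight using that sub by (intro L(3)) auto
    show "norm (PVI_G \<mu> c \<sigma> t u v - PVI_G \<mu> c \<sigma> t u' v') \<le> M * T.weight t * (norm (u - u') + norm (v - v'))"
      if "t \<in> T R" "norm u \<le> 1" "norm v \<le> 1" "norm u' \<le> 1" "norm v' \<le> 1" for t u v u' v'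
      unfolding weight using that sub by (intro L(4)) auto
  qed (rule L(1))
  then obtain p q where pq: "\<And>t. t \<in> T R \<Longrightarrow> (p has_field_derivative q t) (at t) \<and>
      (q has_field_derivative PVI_G \<mu> c \<sigma> t (p t) (q t)) (at t) \<and>
      norm (p t) \<le> (T.gain + T.gain^2) * M * T.weight t \<and> norm (p t) \<le> 1 \<and> norm (q t) \<le> 1"
    by blast
  show ?thesis
  proof (rule exI[of _ R], rule conjI, goal_cases)
    case 1
    show ?case using R1 by (simp add: R_def)
  next
    case 2
    show ?case
    proof (rule exI[of _ p], rule exI[of _ q], rule exI[of _ "(T.gain + T.gain^2) * M"], intro ballI impI conjI)
      fix t assume "t \<in> S" "Re t < R"
      hence t: "t \<in> T R" by (simp add: T_def)
      note * = pq[OF t]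
      show "(p has_field_derivative q t) (at t)" "(q has_field_derivative PVI_G \<mu> c \<sigma> t (p t) (q t)) (at t)"
        "norm (p t) \<le> 1" using * by blast+
      show "norm (p t) \<le> (T.gain + T.gain\<^sup>2) * M * exp (k * Re t)" using * by (simp add: weight)
      show "norm (PVI_y c \<sigma> t (p t)) \<le> 1/2" using * sub t by (intro W2) auto
    qed
  qed
qed

section \<open>Geometry of the domain and the basic estimate\<close>

section \<open>The domain and the asymptotics\<close>

text \<open>Since \<open>ln |x^\<sigma>| = Re (\<sigma> * t)\<close>, the conditions in
  \<open>Dom\<close> are linear in \<open>t\<close>. Strict inequalities with suitable
  \<open>\<alpha>\<close>, \<open>\<beta>\<close> give an open convex set around the domain.\<close>

definition log_sector :: "complex \<Rightarrow> real \<Rightarrow> real \<Rightarrow> real \<Rightarrow> complex set" where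
  "log_sector \<sigma> s \<alpha> \<beta> = {t. Re t < 0 \<and> \<alpha> + s * Re t < Re (\<sigma> * t) \<and> Re (\<sigma> * t) < \<beta>}"

text \<open>Along the ray \<open>Re (\<sigma> * t)\<close> falls at rate
  \<open>Re (\<sigma> * l)\<close> and its lower barrier at rate \<open>s\<close>, so a rate between
  0 and \<open>s\<close> respects both barriers. On the sector \<open>x^(1 - \<sigma>)\<close> is
  \<open>O(|x|^(1 - s))\<close>, hence the exponent.\<close>

lemma contracting_log_sector:
  assumes s: "s < 1" and l: "Re l = 1" "0 \<le> Re (\<sigma> * l)" "Re (\<sigma> * l) \<le> s"
  shows "contracting_domain (log_sector \<sigma> s \<alpha> \<beta>) l (1 - s)"
proof
  have eq: "log_sector \<sigma> s \<alpha> \<beta> = {t. Re t < 0} \<inter> {t. inner (of_real s - cnj \<sigma>) t < - \<alpha>} \<inter> {t. inner (cnj \<sigma>) t < \<beta>}"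
    by (auto simp: log_sector_def inner_complex_def algebra_simps)
  show "open (log_sector \<sigma> s \<alpha> \<beta>)"
    unfolding eq by (intro open_Int open_halfspace_Re_lt open_halfspace_lt)
  show "convex (log_sector \<sigma> s \<alpha> \<beta>)"
    unfolding eq by (intro convex_Int convex_halfspace_Re_lt convex_halfspace_lt)
  show "t - complex_of_real u * l \<in> log_sector \<sigma> s \<alpha> \<beta>" if t: "t \<in> log_sector \<sigma> s \<alpha> \<beta>" and u: "0 \<le> u" for t u
  proof -
    have e: "Re (\<sigma> * (t - of_real u * l)) = Re (\<sigma> * t) - u * Re (\<sigma> * l)" "Re (t - of_real u * l) = Re t - u"
      "s * (Re t - u) = s * Re t - u * s"
      using l(1) by (simp_all add: algebra_simps)
    have "0 \<le> u * Re (\<sigma> * l)" "u * Re (\<sigma> * l) \<le> u * s"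
      using u l by (auto intro: mult_left_mono)
    thus ?thesis using t u unfolding log_sector_def mem_Collect_eq e by (intro conjI; linarith)
  qed
qed (use s l in auto)

text \<open>For real \<open>\<sigma>\<close>, \<open>Omega\<close> leaves
  \<open>0 \<le> \<sigma> < 1\<close> and \<open>l = 1\<close> works. Otherwise \<open>l\<close> is
  the direction of the special paths, where \<open>Re (\<sigma> * l) = 0\<close>.\<close>

lemma exists_contraction_direction:
  assumes "\<sigma> \<in> Omega" "0 < \<sigma>'" "\<sigma>' < 1"
  shows "\<exists>s l. \<sigma>' \<le> s \<and> s < 1 \<and> Re l = 1 \<and> 0 \<le> Re (\<sigma> * l) \<and> Re (\<sigma> * l) \<le> s"
proof (cases "Im \<sigma> = 0")
  case True
  hence "\<sigma> = of_real (Re \<sigma>)" by (simp add: complex_eq_iff)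
  hence "0 \<le> Re \<sigma>" "Re \<sigma> < 1" using assms(1) unfolding Omega_def by force+
  thus ?thesis using assms by (intro exI[of _ "max \<sigma>' (Re \<sigma>)"] exI[of _ 1]) auto
next
  case False
  thus ?thesis using assms
    by (intro exI[of _ \<sigma>'] exI[of _ "Complex 1 (Re \<sigma> / Im \<sigma>)"]) auto
qed

lemma Dom_subset_log_sector:
  assumes "\<sigma>' \<le> s" "\<epsilon> \<le> 1" "\<alpha> < 0" "\<alpha> < - \<theta>1 * Im \<sigma>" "0 < \<beta>" "- \<theta>2 * Im \<sigma> < \<beta>" "0 \<le> s"
  shows "Dom \<epsilon> \<sigma> \<theta>1 \<theta>2 \<sigma>' \<subseteq> log_sector \<sigma> s \<alpha> \<beta>"
proof
  fix t assume t: "t \<in> Dom \<epsilon> \<sigma> \<theta>1 \<theta>2 \<sigma>'"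
  hence "exp (Re t) < \<epsilon>" by (auto simp: Dom_def cabs_eq split: if_splits)
  hence "exp (Re t) < exp 0" using assms(2) unfolding exp_zero by linarith
  hence neg: "Re t < 0" by (simp only: exp_less_cancel_iff)
  show "t \<in> log_sector \<sigma> s \<alpha> \<beta>"
  proof (cases "\<sigma> = 0")
    \<comment> \<open>Here \<open>Dom\<close> puts no bound on \<open>x^\<sigma>\<close>, but
      \<open>Re (\<sigma> * t) = 0\<close> lies between the barriers because
      \<open>\<alpha> < 0 < \<beta>\<close>.\<close>
    case True
    thus ?thesis using neg assms mult_nonneg_nonpos[of s "Re t"] by (auto simp: log_sector_def)
  next
    case False
    hence "exp (- \<theta>1 * Im \<sigma>) * exp (Re t) powr \<sigma>' \<le> exp (Re (\<sigma> * t))" "exp (Re (\<sigma> * t)) \<le> exp (- \<theta>2 * Im \<sigma>)"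
      using t by (auto simp: Dom_def cpow_eq cabs_eq)
    hence "- \<theta>1 * Im \<sigma> + \<sigma>' * Re t \<le> Re (\<sigma> * t)" "Re (\<sigma> * t) \<le> - \<theta>2 * Im \<sigma>"
      by (simp_all only: powr_def exp_add[symmetric] exp_le_cancel_iff ln_exp exp_not_eq_zero if_False)
    moreover have "s * Re t \<le> \<sigma>' * Re t" using assms(1) neg by (intro mult_right_mono_neg) auto
    ultimately show ?thesis using assms neg
      unfolding log_sector_def mem_Collect_eq by (intro conjI; linarith)
  qed
qed

text \<open>One estimate serves all cases: on the whole domain \<open>y / x^(1 - \<sigma>)\<close>
  is a square in \<open>x^\<sigma>\<close> up to \<open>O(|x|^k)\<close>. Whether
  \<open>x^\<sigma>\<close> is small is decided only later.\<close>

lemma PVI_solution_cosh_asymptotics: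
  assumes \<sigma>: "\<sigma> \<in> Omega" and c: "c \<noteq> 0" and \<sigma>': "0 < \<sigma>'" "\<sigma>' < 1"
  shows "\<exists>\<epsilon> Y k B N. 0 < \<epsilon> \<and> \<epsilon> < 1 \<and> 0 < k \<and> k < 1 \<and> PVI_solution \<mu> Y (Dom \<epsilon> \<sigma> \<theta>1 \<theta>2 \<sigma>') \<and>
    (\<forall>t\<in>Dom \<epsilon> \<sigma> \<theta>1 \<theta>2 \<sigma>'. norm (cpow t \<sigma>) \<le> B \<and>
       norm (Y t / cpow t (1 - \<sigma>) - c / 4 * (1 + cpow t \<sigma> / c)^2) \<le> N * cabs t powr k)"
proof -
  obtain s l where s: "\<sigma>' \<le> s" "s < 1" and l: "Re l = 1" "0 \<le> Re (\<sigma> * l)" "Re (\<sigma> * l) \<le> s"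
    using exists_contraction_direction[OF \<sigma> \<sigma>'] by blast
  define k where "k = 1 - s"
  have k: "0 < k" "k < 1" using s \<sigma>' by (auto simp: k_def)
  define \<alpha> where "\<alpha> = min (- \<theta>1 * Im \<sigma>) 0 - 1"
  define \<beta> where "\<beta> = max (- \<theta>2 * Im \<sigma>) 0 + 1"
  define S where "S = log_sector \<sigma> s \<alpha> \<beta>"
  have S: "contracting_domain S l k" unfolding S_def k_def using s l by (intro contracting_log_sector)
  \<comment> \<open>The lower barrier gives the first constant, for
    \<open>c x^(1 - \<sigma>)\<close>; the upper barrier gives the second, for
    \<open>x^(1 + \<sigma>) / c\<close>.\<close>
  define C where "C = max (norm c * exp (- \<alpha>)) (exp \<beta> / norm c)"
  have P: "norm (c * exp ((1 - \<sigma>) * t)) \<le> C * exp (k * Re t)" if "t \<in> S" for t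
  proof -
    have "norm (exp ((1 - \<sigma>) * t)) \<le> exp (- \<alpha> + k * Re t)"
      using that by (simp add: S_def log_sector_def k_def algebra_simps)
    hence "norm (c * exp ((1 - \<sigma>) * t)) \<le> norm c * exp (- \<alpha>) * exp (k * Re t)"
      unfolding norm_mult exp_add mult.assoc by (rule mult_left_mono) simp
    also have "\<dots> \<le> C * exp (k * Re t)" by (intro mult_right_mono) (auto simp: C_def)
    finally show ?thesis .
  qed
  have Q: "norm (exp ((1 + \<sigma>) * t) / c) \<le> C * exp (k * Re t)" if "t \<in> S" for t
  proof -
    have "Re t \<le> k * Re t"
      using that k mult_right_mono_neg[of k 1 "Re t"] by (auto simp: S_def log_sector_def)
    moreover have "Re (\<sigma> * t) \<le> \<beta>" using that by (simp add: S_def log_sector_def)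
    moreover have "Re ((1 + \<sigma>) * t) = Re t + Re (\<sigma> * t)" by (simp add: algebra_simps)
    ultimately have "Re ((1 + \<sigma>) * t) \<le> \<beta> + k * Re t" by linarith
    hence "norm (exp ((1 + \<sigma>) * t)) \<le> exp (\<beta> + k * Re t)"
      unfolding norm_exp_eq_Re exp_le_cancel_iff .
    hence "norm (exp ((1 + \<sigma>) * t) / c) \<le> exp \<beta> / norm c * exp (k * Re t)"
      using c by (simp add: norm_divide exp_add divide_right_mono)
    also have "\<dots> \<le> C * exp (k * Re t)" by (intro mult_right_mono) (auto simp: C_def)
    finally show ?thesis .
  qed
  obtain R p q N where R: "R < 0" and sol: "\<And>t. t \<in> S \<Longrightarrow> Re t < R \<Longrightarrow>
      (p has_field_derivative q t) (at t) \<and>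
      (q has_field_derivative PVI_G \<mu> c \<sigma> t (p t) (q t)) (at t) \<and>
      norm (p t) \<le> N * exp (k * Re t) \<and> norm (p t) \<le> 1 \<and> norm (PVI_y c \<sigma> t (p t)) \<le> 1/2"
    using PVI_log_solution[OF S less_imp_le[OF k(2)] c P Q] by blast
  define T where "T = S \<inter> {t. Re t < R}"
  define \<epsilon> where "\<epsilon> = exp R"
  have \<epsilon>: "0 < \<epsilon>" "\<epsilon> < 1" using R by (auto simp: \<epsilon>_def)
  have sub: "Dom \<epsilon> \<sigma> \<theta>1 \<theta>2 \<sigma>' \<subseteq> T"
  proof -
    have "Dom \<epsilon> \<sigma> \<theta>1 \<theta>2 \<sigma>' \<subseteq> S"
      unfolding S_def by (rule Dom_subset_log_sector) (use s \<sigma>' \<epsilon> in \<open>auto simp: \<alpha>_def \<beta>_def\<close>)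
    moreover have "Dom \<epsilon> \<sigma> \<theta>1 \<theta>2 \<sigma>' \<subseteq> {t. Re t < R}"
      by (auto simp: Dom_def cabs_eq \<epsilon>_def split: if_splits)
    ultimately show ?thesis by (auto simp: T_def)
  qed
  define Y where "Y = (\<lambda>t. PVI_y c \<sigma> t (p t))"
  have "open T" unfolding T_def using contracting_domain.open_S[OF S] by (intro open_Int open_halfspace_Re_lt)
  hence "PVI_solution \<mu> Y T"
    unfolding Y_def using c sol R by (intro PVI_solution_of_log_solution[where q = q]) (auto simp: T_def)
  hence Y: "PVI_solution \<mu> Y (Dom \<epsilon> \<sigma> \<theta>1 \<theta>2 \<sigma>')"
    using sub by (auto simp: PVI_solution_def intro: analytic_on_subset)
  have zB: "norm (cpow t \<sigma>) \<le> exp \<beta>" if "t \<in> T" for t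
    using that by (simp add: T_def S_def log_sector_def cpow_eq)
  define N' where "N' = (norm c + (exp \<beta>)^2 / norm c) * exp 1 * N / 4"
  have est: "norm (Y t / cpow t (1 - \<sigma>) - c / 4 * (1 + cpow t \<sigma> / c)^2) \<le> N' * cabs t powr k" if t: "t \<in> T" for t
  proof -
    define z where "z = cpow t \<sigma>"
    define g where "g = cpow t (1 - \<sigma>)"
    have g: "g \<noteq> 0" "exp ((1 - \<sigma>) * t) = g" by (simp_all add: g_def cpow_eq)
    have gz: "exp t = g * z" "exp ((1 + \<sigma>) * t) = g * z^2"
      by (simp_all add: g_def z_def cpow_eq power2_eq_square flip: exp_add) (simp_all add: algebra_simps)
    have "Y t / g = (c * exp (p t) + 2 * z + z^2 / c * exp (- p t)) / 4"
      unfolding Y_def PVI_y_def g(2) gz using g(1) c by (simp add: field_simps)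
    \<comment> \<open>The square is the value at \<open>p t = 0\<close>, so the error is linear in
      \<open>norm (p t)\<close>, hence \<open>O(|x|^k)\<close>.\<close>
    hence "Y t / g - c / 4 * (1 + z / c)^2 = (c * (exp (p t) - exp 0) + z^2 / c * (exp (- p t) - exp 0)) / 4"
      using c by (simp add: field_simps power2_eq_square)
    also have "norm \<dots> \<le> (norm c * (exp 1 * norm (p t)) + (exp \<beta>)^2 / norm c * (exp 1 * norm (p t))) / 4"
    proof -
      have p1: "norm (p t) \<le> 1" using sol[of t] t by (auto simp: T_def)
      have "norm (c * (exp (p t) - exp 0)) \<le> norm c * (exp 1 * norm (p t))"
        unfolding norm_mult using norm_exp_diff_le[of "p t" 0] p1 by (intro mult_left_mono) auto
      moreover have "norm (z^2 / c * (exp (- p t) - exp 0)) \<le> (exp \<beta>)^2 / norm c * (exp 1 * norm (p t))"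
        unfolding norm_mult norm_divide norm_power
        using norm_exp_diff_le[of "- p t" 0] p1 zB[OF t]
        by (intro mult_mono divide_right_mono power_mono) (auto simp: z_def)
      ultimately show ?thesis
        unfolding norm_divide using norm_triangle_mono by fastforce
    qed
    also have "\<dots> = (norm c + (exp \<beta>)^2 / norm c) * exp 1 / 4 * norm (p t)"
      by (simp add: algebra_simps)
    also have "\<dots> \<le> (norm c + (exp \<beta>)^2 / norm c) * exp 1 / 4 * (N * exp (k * Re t))"
      using sol[of t] t by (intro mult_left_mono) (auto simp: T_def)
    also have "\<dots> = N' * cabs t powr k" by (simp add: N'_def cabs_eq powr_def)
    finally show ?thesis by (simp add: z_def g_def)
  qed
  show ?thesis
    by (rule exI[of _ \<epsilon>], rule exI[of _ Y], rule exI[of _ k], rule exI[of _ "exp \<beta>"], rule exI[of _ N'])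
       (use \<epsilon> k Y zB est sub in blast)
qed

section \<open>From the basic estimate to the asserted behaviours\<close>

lemma bigo_to_zero_inI:
  assumes "\<And>t. t \<in> S \<Longrightarrow> norm (E t) \<le> M * norm (h t)"
  shows "E \<in> O[to_zero_in S](h)"
  by (rule bigoI[where c = M]) (use assms in \<open>auto simp: to_zero_in_def eventually_inf_principal\<close>)

lemma asymp_multI:
  assumes "\<And>t. t \<in> S \<Longrightarrow> g t \<noteq> 0"
    and "\<And>t. t \<in> S \<Longrightarrow> norm (Y t / g t - 1) \<le> M * cabs t powr \<delta>"
  shows "asymp_mult Y g \<delta> S"
  unfolding asymp_mult_def
proof (intro exI conjI ballI)
  show "Y t = g t * (1 + (Y t / g t - 1))" if "t \<in> S" for t using assms(1)[OF that] by simp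
  show "(\<lambda>t. norm (Y t / g t - 1)) \<in> O[to_zero_in S](\<lambda>t. cabs t powr \<delta>)"
    by (rule bigo_to_zero_inI[where M = M]) (use assms(2) in auto)
qed

lemma cpow_nonzero [simp]: "cpow t \<sigma> \<noteq> 0"
  by (simp add: cpow_eq)

lemma Dom_cabs_less: "t \<in> Dom \<epsilon> \<sigma> \<theta>1 \<theta>2 \<sigma>' \<Longrightarrow> cabs t < \<epsilon>"
  by (auto simp: Dom_def split: if_splits)

text \<open>Expanding the square leaves 1 plus a multiple of \<open>x^\<sigma>\<close>, which is
  \<open>O(|x|^s)\<close>; together with the error \<open>O(|x|^k)\<close> this gives the exponent
  \<open>min s k\<close>.\<close>

lemma asymp_mult_of_small_cpow:
  assumes a: "a \<noteq> 0" and k: "0 < k" "k < 1" and s: "0 < s"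
    and D: "\<And>t. t \<in> D \<Longrightarrow> cabs t < 1" "\<And>t. t \<in> D \<Longrightarrow> norm (cpow t \<sigma>) \<le> B"
    and est: "\<And>t. t \<in> D \<Longrightarrow> norm (Y t / cpow t (1 - \<sigma>) - a * (1 + cpow t \<sigma> / (4 * a))^2) \<le> N * cabs t powr k"
    and z: "\<And>t. t \<in> D \<Longrightarrow> norm (cpow t \<sigma>) \<le> K * cabs t powr s"
  shows "\<exists>\<delta>. 0 < \<delta> \<and> \<delta> < 1 \<and> asymp_mult Y (\<lambda>t. a * cpow t (1 - \<sigma>)) \<delta> D"
proof (intro exI conjI)
  define \<delta> where "\<delta> = min s k"
  show "0 < \<delta>" "\<delta> < 1" using k s by (auto simp: \<delta>_def)
  show "asymp_mult Y (\<lambda>t. a * cpow t (1 - \<sigma>)) \<delta> D"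
  proof (rule asymp_multI)
    fix t assume t: "t \<in> D"
    show "a * cpow t (1 - \<sigma>) \<noteq> 0" using a by simp
    define x z where "x = Y t / cpow t (1 - \<sigma>)" and "z = cpow t \<sigma>"
    have pw: "cabs t powr k \<le> cabs t powr \<delta>" "cabs t powr s \<le> cabs t powr \<delta>"
      using D(1)[OF t] by (auto simp: \<delta>_def cabs_eq powr_def)
    have B0: "0 \<le> B" using D(2)[OF t] norm_ge_zero order_trans by blast
    have K0: "0 \<le> K"
    proof -
      have "0 \<le> K * cabs t powr s" using z[OF t] norm_ge_zero order_trans by blast
      thus ?thesis by (simp add: zero_le_mult_iff cabs_eq)
    qed
    have N0: "0 \<le> N"
    proof -
      have "0 \<le> N * cabs t powr k" using est[OF t] norm_ge_zero order_trans by blast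
      thus ?thesis by (simp add: zero_le_mult_iff cabs_eq)
    qed
    have "Y t / (a * cpow t (1 - \<sigma>)) - 1 = (x - a * (1 + z / (4 * a))^2) / a + z * (1 / (2 * a) + z / (16 * a^2))"
      using a by (simp add: x_def field_simps power2_eq_square)
    also have "norm \<dots> \<le> N * cabs t powr \<delta> / norm a + K * cabs t powr \<delta> * (1 / (2 * norm a) + B / (16 * (norm a)^2))"
    proof (rule norm_triangle_mono)
      show "norm ((x - a * (1 + z / (4 * a))^2) / a) \<le> N * cabs t powr \<delta> / norm a"
        unfolding norm_divide x_def z_def
        using order_trans[OF est[OF t] mult_left_mono[OF pw(1) N0]] by (rule divide_right_mono) simp
      have "norm (1 / (2 * a) + z / (16 * a^2)) \<le> 1 / (2 * norm a) + B / (16 * (norm a)^2)"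
        by (rule norm_triangle_mono) (use D(2)[OF t] in \<open>auto simp: norm_divide norm_mult norm_power z_def intro: divide_right_mono\<close>)
      moreover have "norm z \<le> K * cabs t powr \<delta>"
        using order_trans[OF z[OF t] mult_left_mono[OF pw(2) K0]] by (simp add: z_def)
      ultimately show "norm (z * (1 / (2 * a) + z / (16 * a^2))) \<le> K * cabs t powr \<delta> * (1 / (2 * norm a) + B / (16 * (norm a)^2))"
        unfolding norm_mult using K0 by (intro mult_mono) auto
    qed
    also have "\<dots> = (N / norm a + K * (1 / (2 * norm a) + B / (16 * (norm a)^2))) * cabs t powr \<delta>"
      by (simp add: algebra_simps)
    finally show "norm (Y t / (a * cpow t (1 - \<sigma>)) - 1) \<le> \<dots>" .
  qed
qed

text \<open>
  For \<open>\<sigma> = 0\<close> the terms \<open>x^(1 - \<sigma>)\<close>, \<open>x\<close>, \<open>x^(1 + \<sigma>)\<close> have the same size, so \<open>c = 4 a\<close> has to be replaced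
  by a solution of the equation below.
\<close>

lemma cosh_square_parameter:
  fixes a :: complex
  shows "\<exists>c. c \<noteq> 0 \<and> c / 4 * (1 + 1 / c)^2 = a"
proof -
  \<comment> \<open>A root of \<open>(c + 1)^2 = 4 * a * c\<close>; it is nonzero because
    \<open>c = 0\<close> would give \<open>1 = 0\<close>.\<close>
  define c where "c = (2 * a - 1) + csqrt ((2 * a - 1)^2 - 1)"
  have "(c - (2 * a - 1))^2 = (2 * a - 1)^2 - 1" by (simp add: c_def)
  hence c: "(c + 1)^2 = 4 * a * c" by (simp add: power2_eq_square algebra_simps)
  hence nz: "c \<noteq> 0" by auto
  have "c / 4 * (1 + 1 / c)^2 = (c + 1)^2 / (4 * c)"
    using nz by (simp add: field_simps power2_eq_square)
  also have "\<dots> = a" unfolding c using nz by simp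
  finally show ?thesis using nz by blast
qed

text \<open>On the path the real part of \<open>\<sigma> * t\<close> is \<open>- d\<close> and its
  imaginary part is \<open>phase \<sigma> t\<close>.\<close>

lemma cpow_on_special_path:
  assumes "t \<in> special_path \<sigma> d"
  shows "cpow t \<sigma> = of_real (exp (- d)) * exp (\<i> * of_real (phase \<sigma> t))"
proof -
  have "Im \<sigma> * Im t = Re \<sigma> * Re t + d"
    using assms by (simp add: special_path_def carg_def cabs_eq)
  hence "\<sigma> * t = of_real (- d) + \<i> * of_real (phase \<sigma> t)"
    by (simp add: complex_eq_iff phase_def carg_def cabs_eq)
  thus ?thesis by (simp only: cpow_eq exp_add exp_of_real)
qed

lemma coeff_along_special_path:
  assumes "t \<in> special_path \<sigma> d" "a \<noteq> 0"
  shows "coeff_along \<sigma> a (exp (- d)) t = a * (1 + cpow t \<sigma> / (4 * a))^2"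
proof -
  define e where "e = exp (\<i> * of_real (phase \<sigma> t))"
  define C :: complex where "C = of_real (exp (- d))"
  have "exp (2 * \<i> * of_real (phase \<sigma> t)) = e^2"
    by (simp add: e_def power2_eq_square mult.assoc flip: exp_add)
  moreover have "a * (1 + 1 / (2*a) * C * e + 1 / (16 * a^2) * C ^ 2 * e^2) = a * (1 + C * e / (4 * a))^2"
    using assms(2) by (simp add: field_simps power2_eq_square)
  ultimately show ?thesis
    unfolding coeff_along_def cpow_on_special_path[OF assms(1)] e_def C_def by simp
qed

theorem theorem1:
  fixes \<mu> \<sigma> a :: complex and \<theta>1 \<theta>2 \<sigma>' :: real
  assumes "\<mu> \<noteq> 0" and "\<sigma> \<in> Omega" and "a \<noteq> 0" and "0 < \<sigma>'" and "\<sigma>' < 1"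
  shows "\<exists>\<epsilon> Y. 0 < \<epsilon> \<and> \<epsilon> < 1 \<and>
    PVI_solution \<mu> Y (Dom \<epsilon> \<sigma> \<theta>1 \<theta>2 \<sigma>') \<and>
    (Im \<sigma> = 0 \<longrightarrow>
      (\<exists>\<delta>. 0 < \<delta> \<and> \<delta> < 1 \<and>
        asymp_mult Y (\<lambda>t. a * cpow t (1 - \<sigma>)) \<delta> (Dom \<epsilon> \<sigma> \<theta>1 \<theta>2 \<sigma>'))) \<and>
    (Im \<sigma> \<noteq> 0 \<longrightarrow>
      (\<forall>s>0. \<forall>K>0. \<exists>\<delta>. 0 < \<delta> \<and> \<delta> < 1 \<and>
        asymp_mult Y (\<lambda>t. a * cpow t (1 - \<sigma>)) \<delta>
          (Dom \<epsilon> \<sigma> \<theta>1 \<theta>2 \<sigma>' \<inter> off_special \<sigma> s K))) \<and>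
    (Im \<sigma> \<noteq> 0 \<longrightarrow>
      (\<forall>d. (\<forall>\<^sub>F t in to_zero_in (special_path \<sigma> d). t \<in> Dom \<epsilon> \<sigma> \<theta>1 \<theta>2 \<sigma>') \<longrightarrow>
        (let C = exp (- d);
             A = coeff_along \<sigma> a C;
             P = special_path \<sigma> d \<inter> Dom \<epsilon> \<sigma> \<theta>1 \<theta>2 \<sigma>'
         in (\<forall>t\<in>P. cpow t \<sigma> = of_real C * exp (\<i> * of_real (phase \<sigma> t))) \<and>
            A \<in> O[to_zero_in P](\<lambda>_. 1) \<and>
            (\<exists>\<delta>. 0 < \<delta> \<and> \<delta> < 1 \<and>
              asymp_add Y A (\<lambda>t. cpow t (1 - \<sigma>)) \<delta> P \<and>
              (C \<noteq> 4 * norm a \<longrightarrow>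
                asymp_mult Y (\<lambda>t. A t * cpow t (1 - \<sigma>)) \<delta> P)))))"
proof -
  define c where "c = (if \<sigma> = 0 then (SOME c. c \<noteq> 0 \<and> c / 4 * (1 + 1 / c)^2 = a) else 4 * a)"
  have c0: "c \<noteq> 0 \<and> c / 4 * (1 + 1 / c)^2 = a" if "\<sigma> = 0"
    using someI_ex[OF cosh_square_parameter[of a]] that by (simp add: c_def)
  have c: "c \<noteq> 0" using c0 assms(3) by (cases "\<sigma> = 0") (auto simp: c_def)
  obtain \<epsilon> Y k B N where \<epsilon>: "0 < \<epsilon>" "\<epsilon> < 1" and k: "0 < k" "k < 1"
    and Y: "PVI_solution \<mu> Y (Dom \<epsilon> \<sigma> \<theta>1 \<theta>2 \<sigma>')"
    and est: "\<forall>t\<in>Dom \<epsilon> \<sigma> \<theta>1 \<theta>2 \<sigma>'. norm (cpow t \<sigma>) \<le> B \<and>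
       norm (Y t / cpow t (1 - \<sigma>) - c / 4 * (1 + cpow t \<sigma> / c)^2) \<le> N * cabs t powr k"
    using PVI_solution_cosh_asymptotics[OF assms(2) c assms(4,5)] by metis
  let ?D = "Dom \<epsilon> \<sigma> \<theta>1 \<theta>2 \<sigma>'"
  have B: "norm (cpow t \<sigma>) \<le> B" if "t \<in> ?D" for t using est that by blast
  have lt1: "cabs t < 1" if "t \<in> ?D" for t using Dom_cabs_less[OF that] \<epsilon> by linarith
  have E: "norm (Y t / cpow t (1 - \<sigma>) - a * (1 + cpow t \<sigma> / (4 * a))^2) \<le> N * cabs t powr k"
    if "\<sigma> \<noteq> 0" "t \<in> ?D" for t
    using est that by (simp add: c_def)
  \<comment> \<open>Here \<open>x^\<sigma> = 1\<close>, so the square is constant, and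
    \<open>c\<close> was chosen to make it equal to \<open>a\<close>.\<close>
  have zero: "asymp_mult Y (\<lambda>t. a * cpow t (1 - \<sigma>)) k ?D" if \<sigma>: "\<sigma> = 0"
  proof (rule asymp_multI)
    fix t assume t: "t \<in> ?D"
    show "a * cpow t (1 - \<sigma>) \<noteq> 0" using assms(3) by simp
    define x where "x = Y t / cpow t (1 - \<sigma>)"
    have "norm (x - c / 4 * (1 + cpow t \<sigma> / c)^2) \<le> N * cabs t powr k"
      using est t by (simp add: x_def)
    moreover have "c / 4 * (1 + cpow t \<sigma> / c)^2 = a" using c0[OF \<sigma>] \<sigma> by (simp add: cpow_eq)
    ultimately have "norm (x - a) \<le> N * cabs t powr k" by simp
    hence "norm (x - a) / norm a \<le> N * cabs t powr k / norm a" by (rule divide_right_mono) simp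
    moreover have "Y t / (a * cpow t (1 - \<sigma>)) - 1 = (x - a) / a"
      using assms(3) by (simp add: x_def field_simps)
    ultimately show "norm (Y t / (a * cpow t (1 - \<sigma>)) - 1) \<le> N / norm a * cabs t powr k"
      by (simp add: norm_divide)
  qed
  have small: "\<exists>\<delta>. 0 < \<delta> \<and> \<delta> < 1 \<and> asymp_mult Y (\<lambda>t. a * cpow t (1 - \<sigma>)) \<delta> D'"
    if "\<sigma> \<noteq> 0" "D' \<subseteq> ?D" "0 < s" "\<And>t. t \<in> D' \<Longrightarrow> norm (cpow t \<sigma>) \<le> K * cabs t powr s" for D' s K
    by (rule asymp_mult_of_small_cpow[OF assms(3) k that(3), where B = B and N = N and K = K])
       (use lt1 B E that in auto)
  have real_case: "\<exists>\<delta>. 0 < \<delta> \<and> \<delta> < 1 \<and> asymp_mult Y (\<lambda>t. a * cpow t (1 - \<sigma>)) \<delta> ?D" if im: "Im \<sigma> = 0"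
  proof (cases "\<sigma> = 0")
    case True
    thus ?thesis using zero k by blast
  next
    case False
    have "\<sigma> = of_real (Re \<sigma>)" using im by (simp add: complex_eq_iff)
    hence "0 \<le> Re \<sigma>" using assms(2) unfolding Omega_def by force
    moreover have "Re \<sigma> \<noteq> 0" using im False by (simp add: complex_eq_iff)
    ultimately have "0 < Re \<sigma>" by simp
    \<comment> \<open>For real positive \<open>\<sigma>\<close> the smallness of
      \<open>x^\<sigma>\<close> is automatic, with \<open>s = Re \<sigma>\<close> and
      \<open>K = 1\<close>.\<close>
    moreover have "norm (cpow t \<sigma>) \<le> 1 * cabs t powr Re \<sigma>" for t
      using im by (simp add: cpow_eq cabs_eq powr_def)
    ultimately show ?thesis by (rule small[OF False subset_refl])
  qed
  have generic_case: "\<exists>\<delta>. 0 < \<delta> \<and> \<delta> < 1 \<and> asymp_mult Y (\<lambda>t. a * cpow t (1 - \<sigma>)) \<delta> (?D \<inter> off_special \<sigma> s K)"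
    if "Im \<sigma> \<noteq> 0" "0 < s" for s K
    by (rule small[OF _ _ that(2), where K = K]) (use that in \<open>auto simp: off_special_def\<close>)
  have path_case: "let C = exp (- d); A = coeff_along \<sigma> a C; P = special_path \<sigma> d \<inter> ?D
         in (\<forall>t\<in>P. cpow t \<sigma> = of_real C * exp (\<i> * of_real (phase \<sigma> t))) \<and>
            A \<in> O[to_zero_in P](\<lambda>_. 1) \<and>
            (\<exists>\<delta>. 0 < \<delta> \<and> \<delta> < 1 \<and>
              asymp_add Y A (\<lambda>t. cpow t (1 - \<sigma>)) \<delta> P \<and>
              (C \<noteq> 4 * norm a \<longrightarrow>
                asymp_mult Y (\<lambda>t. A t * cpow t (1 - \<sigma>)) \<delta> P))" if im: "Im \<sigma> \<noteq> 0" for d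
  proof -
    define C where "C = exp (- d)"
    define A where "A = coeff_along \<sigma> a C"
    define P where "P = special_path \<sigma> d \<inter> ?D"
    have \<sigma>: "\<sigma> \<noteq> 0" using im by auto
    have z: "cpow t \<sigma> = of_real C * exp (\<i> * of_real (phase \<sigma> t))" if "t \<in> P" for t
      unfolding C_def by (rule cpow_on_special_path) (use that P_def in auto)
    have nz: "norm (cpow t \<sigma>) = C" if "t \<in> P" for t
      unfolding z[OF that] norm_mult by (simp add: C_def)
    have A: "A t = a * (1 + cpow t \<sigma> / (4 * a))^2" if "t \<in> P" for t
      unfolding A_def C_def by (rule coeff_along_special_path) (use that P_def assms(3) in auto)
    have EP: "norm (Y t / cpow t (1 - \<sigma>) - A t) \<le> N * cabs t powr k" if "t \<in> P" for t
      unfolding A[OF that] by (rule E[OF \<sigma>]) (use that P_def in auto)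
    have bounded: "A \<in> O[to_zero_in P](\<lambda>_. 1)"
    proof (rule bigo_to_zero_inI)
      fix t assume t: "t \<in> P"
      have "norm (1 + cpow t \<sigma> / (4 * a)) \<le> 1 + C / (4 * norm a)"
        using norm_triangle_ineq[of 1 "cpow t \<sigma> / (4 * a)"] nz[OF t] by (simp add: norm_divide norm_mult)
      hence "norm (1 + cpow t \<sigma> / (4 * a))^2 \<le> (1 + C / (4 * norm a))^2" by (rule power_mono) simp
      thus "norm (A t) \<le> (norm a * (1 + C / (4 * norm a))^2) * norm (1::complex)"
        unfolding A[OF t] norm_mult norm_power by (simp add: mult_left_mono)
    qed
    have add: "asymp_add Y A (\<lambda>t. cpow t (1 - \<sigma>)) k P"
      unfolding asymp_add_def
    proof (rule exI[of _ "\<lambda>t. Y t / cpow t (1 - \<sigma>) - A t"], intro conjI ballI)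
      show "Y t = (A t + (Y t / cpow t (1 - \<sigma>) - A t)) * cpow t (1 - \<sigma>)" for t by simp
      show "(\<lambda>t. norm (Y t / cpow t (1 - \<sigma>) - A t)) \<in> O[to_zero_in P](\<lambda>t. cabs t powr k)"
        by (rule bigo_to_zero_inI[where M = N]) (use EP in auto)
    qed
    have mult: "asymp_mult Y (\<lambda>t. A t * cpow t (1 - \<sigma>)) k P" if ne: "C \<noteq> 4 * norm a"
    proof -
      \<comment> \<open>On the path \<open>|x^\<sigma>| = C\<close>, so \<open>m\<close> is a lower
        bound for \<open>norm (A t)\<close>, positive when \<open>C \<noteq> 4 * norm a\<close>.
        Dividing the additive error by \<open>A t\<close> then costs only the factor
        \<open>1 / m\<close>.\<close>
      define m where "m = norm a * \<bar>1 - C / (4 * norm a)\<bar>^2"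
      have m: "0 < m" using ne assms(3) by (auto simp: m_def field_simps)
      have mA: "m \<le> norm (A t)" if t: "t \<in> P" for t
      proof -
        have "\<bar>1 - C / (4 * norm a)\<bar> \<le> norm (1 + cpow t \<sigma> / (4 * a))"
          using norm_triangle_ineq3[of 1 "- (cpow t \<sigma> / (4 * a))"] nz[OF t]
          by (simp add: norm_divide norm_mult)
        hence "\<bar>1 - C / (4 * norm a)\<bar>^2 \<le> norm (1 + cpow t \<sigma> / (4 * a))^2" by (rule power_mono) simp
        thus ?thesis unfolding A[OF t] norm_mult norm_power m_def by (intro mult_left_mono) auto
      qed
      show ?thesis
      proof (rule asymp_multI)
        fix t assume t: "t \<in> P"
        have A0: "A t \<noteq> 0" using mA[OF t] m by auto
        thus "A t * cpow t (1 - \<sigma>) \<noteq> 0" by simp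
        have "Y t / (A t * cpow t (1 - \<sigma>)) - 1 = (Y t / cpow t (1 - \<sigma>) - A t) / A t"
          using A0 by (simp add: field_simps)
        also have "norm \<dots> \<le> N * cabs t powr k / m"
          unfolding norm_divide[of _ "A t"]
          using EP[OF t] mA[OF t] m order_trans[OF norm_ge_zero EP[OF t]] by (intro frac_le) auto
        finally show "norm (Y t / (A t * cpow t (1 - \<sigma>)) - 1) \<le> N / m * cabs t powr k" by simp
      qed
    qed
    show ?thesis
      unfolding Let_def C_def[symmetric] A_def[symmetric] P_def[symmetric]
      using z bounded add mult k by blast
  qed
  show ?thesis
    by (rule exI[of _ \<epsilon>], rule exI[of _ Y])
       (intro conjI impI allI \<epsilon> Y real_case generic_case path_case; assumption)
qed

end
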